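(* Let $K$ be a continuum (not necessarily metrizable). The following are equivalent: 1) $K$ is $\aleph_0$--ac; 2) $K$ is a continuous injective image of a closed sub-interval of the long line; 3) $K$ is (homeomorphic to) one of: the arc, the long circle, the long lollipop, the long dumbbell, the long figure eight or the long theta-curve.
   Context: A continuum here is a compact connected Hausdorff space. An arc is a space homeomorphic to $[0,1]$. A space $X$ is $\aleph_0$--ac if for every countable subset $S$ of $X$ there is an arc in $X$ (a subspace homeomorphic to $[0,1]$) containing $S$. The long ray $R$ is the lexicographic product of $\omega_1$ with $[0,1)$ with the order topology; $\omega_1$ is identified with $\omega_1\times\{0\}$. $R^-$ is $R$ with each point $x$ relabeled $-x$, and the long line $L$ is obtained by identifying $0$ in $R$ with $-0$ in $R^-$ (linearly ordered in the natural way, with $R^-$ below $R$). Intervals are taken to have more than one point. $\alpha R$ denotes the one point compactification of $R$, and $\gamma L$ the corresponding two point compactification of $L$, with added endpoints $-\infty$ and $+\infty$. The long circle is obtained from $\alpha R$ by identifying the point at infinity with $0$; the long lollipop is obtained from $\alpha R$ by identifying the point at infinity with a point of $R$ other than $0$. The long dumbbell is obtained from $\gamma L$ by identifying $-\infty$ with $-1$ and $+\infty$ with $+1$; the long figure eight by identifying both $-\infty$ and $+\infty$ with $0$; the long theta-curve by identifying $-\infty$ with $+1$ and $+\infty$ with $-1$. *)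

theory Defs
  imports
    "HOL-Analysis.Analysis"
    "HOL-Library.Extended"
begin

section \<open>The ordinal \<open>\<omega>\<^sub>1\<close>\<close>

text \<open>\<open>cardSuc natLeq\<close> is a well-order whose order type is the least uncountable ordinal.\<close>

lemma Card_order_cardSuc_natLeq: "Card_order (cardSuc natLeq)"
  by (rule cardSuc_Card_order[OF natLeq_Card_order])

lemma Well_order_cardSuc_natLeq: "Well_order (cardSuc natLeq)"
  using Card_order_cardSuc_natLeq by (rule card_order_on_well_order_on)

lemma uncountable_Field_cardSuc_natLeq:
  includes cardinal_syntax
  shows "uncountable (Field (cardSuc natLeq))"
proof
  let ?F = "Field (cardSuc natLeq)"
  assume "countable ?F"
  then have "|?F| \<le>o |UNIV :: nat set|"
    unfolding countable_def using card_of_ordLeq[of ?F "UNIV :: nat set"] by auto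
  then have "|?F| \<le>o natLeq"
    using card_of_nat ordLeq_ordIso_trans by blast
  moreover have "|?F| =o cardSuc natLeq"
    using card_of_Field_ordIso[OF Card_order_cardSuc_natLeq] .
  ultimately have "cardSuc natLeq \<le>o natLeq"
    using ordIso_symmetric ordIso_ordLeq_trans by blast
  then show False
    using cardSuc_greater[OF natLeq_Card_order] not_ordLess_ordLeq by blast
qed

typedef omega1 = "Field (cardSuc natLeq)"
  using uncountable_Field_cardSuc_natLeq by (metis countable_empty ex_in_conv)

instantiation omega1 :: linorder
begin

definition less_eq_omega1 :: "omega1 \<Rightarrow> omega1 \<Rightarrow> bool" where
  "a \<le> b \<longleftrightarrow> (Rep_omega1 a, Rep_omega1 b) \<in> cardSuc natLeq"

definition less_omega1 :: "omega1 \<Rightarrow> omega1 \<Rightarrow> bool" where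
  "(a :: omega1) < b \<longleftrightarrow> a \<le> b \<and> \<not> b \<le> a"

instance
proof
  have R: "refl_on (Field (cardSuc natLeq)) (cardSuc natLeq)"
    and T: "trans (cardSuc natLeq)" and A: "antisym (cardSuc natLeq)"
    and L: "total_on (Field (cardSuc natLeq)) (cardSuc natLeq)"
    using Well_order_cardSuc_natLeq
    by (auto simp: well_order_on_def linear_order_on_def partial_order_on_def preorder_on_def)
  fix x y z :: omega1
  show "x < y \<longleftrightarrow> x \<le> y \<and> \<not> y \<le> x" by (rule less_omega1_def)
  show "x \<le> x" using R Rep_omega1[of x] by (auto simp: less_eq_omega1_def refl_on_def)
  show "x \<le> z" if "x \<le> y" "y \<le> z"
    using that T unfolding less_eq_omega1_def by (meson transD)
  show "x = y" if "x \<le> y" "y \<le> x"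
    using that A unfolding less_eq_omega1_def by (meson Rep_omega1_inject antisymD)
  show "x \<le> y \<or> y \<le> x"
    using L Rep_omega1[of x] Rep_omega1[of y] \<open>x \<le> x\<close>
    unfolding less_eq_omega1_def total_on_def by (cases "x = y") (auto simp: Rep_omega1_inject)
qed

end

instance omega1 :: wellorder
proof
  fix P :: "omega1 \<Rightarrow> bool" and a
  assume step: "\<And>x. (\<And>y. y < x \<Longrightarrow> P y) \<Longrightarrow> P x"
  have "wf (inv_image (cardSuc natLeq - Id) Rep_omega1)"
    using Well_order_cardSuc_natLeq by (intro wf_inv_image) (simp add: well_order_on_def)
  then show "P a"
  proof (induction a rule: wf_induct_rule)
    case (less x)
    show ?case
    proof (rule step)
      fix y assume "y < x"
      then have "(y, x) \<in> inv_image (cardSuc natLeq - Id) Rep_omega1"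
        by (auto simp: less_omega1_def less_eq_omega1_def)
      then show "P y" by (rule less)
    qed
  qed
qed

lemma uncountable_omega1: "uncountable (UNIV :: omega1 set)"
proof
  assume "countable (UNIV :: omega1 set)"
  then have "countable (range Rep_omega1)" by (rule countable_image)
  moreover have "range Rep_omega1 = Field (cardSuc natLeq)"
    using type_definition.Rep_range[OF type_definition_omega1] .
  ultimately show False using uncountable_Field_cardSuc_natLeq by simp
qed

lemma countable_lessThan_omega1:
  includes cardinal_syntax
  shows "countable {..<a :: omega1}"
proof -
  let ?r = "cardSuc natLeq"
  have "|underS ?r (Rep_omega1 a)| <o ?r"
    using card_of_underS[OF Card_order_cardSuc_natLeq Rep_omega1] .
  then have "|underS ?r (Rep_omega1 a)| \<le>o natLeq"
    using cardSuc_ordLeq_ordLess[OF natLeq_Card_order card_of_Card_order] by blast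
  then have "|underS ?r (Rep_omega1 a)| \<le>o |UNIV :: nat set|"
    using card_of_nat ordIso_symmetric ordLeq_ordIso_trans by blast
  then have "countable (underS ?r (Rep_omega1 a))"
    unfolding countable_def using card_of_ordLeq[of "underS ?r (Rep_omega1 a)" "UNIV :: nat set"] by auto
  moreover have "Rep_omega1 ` {..<a} \<subseteq> underS ?r (Rep_omega1 a)"
    by (auto simp: underS_def less_omega1_def less_eq_omega1_def)
  ultimately have "countable (Rep_omega1 ` {..<a})" by (rule countable_subset[rotated])
  then show ?thesis
    by (rule countable_image_inj_on) (simp add: inj_on_def Rep_omega1_inject)
qed

instantiation omega1 :: "{zero, one}"
begin

definition zero_omega1 :: omega1 where "0 = (LEAST a :: omega1. True)"

definition one_omega1 :: omega1 where "1 = (LEAST a :: omega1. 0 < a)"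

instance ..

end

lemma omega1_zero_le [simp]: "(0 :: omega1) \<le> a"
  unfolding zero_omega1_def by (rule Least_le) simp

lemma omega1_zero_less_one [simp]: "(0 :: omega1) < 1"
proof -
  have "\<exists>a :: omega1. 0 < a"
  proof (rule ccontr)
    assume "\<nexists>a :: omega1. 0 < a"
    then have "UNIV = {0 :: omega1}" by (auto simp: not_less intro: antisym)
    then show False using uncountable_omega1 by (metis countable_empty countable_insert)
  qed
  then show ?thesis unfolding one_omega1_def by (rule LeastI_ex)
qed


section \<open>The long ray\<close>

typedef long_ray = "{(a :: omega1, t :: real). 0 \<le> t \<and> t < 1}"
  by (rule exI[of _ "(0, 0)"]) simp

instantiation long_ray :: linorder
begin

definition less_eq_long_ray :: "long_ray \<Rightarrow> long_ray \<Rightarrow> bool" where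
  "x \<le> y \<longleftrightarrow> (case (Rep_long_ray x, Rep_long_ray y) of
     ((a, s), (b, t)) \<Rightarrow> a < b \<or> a = b \<and> s \<le> t)"

definition less_long_ray :: "long_ray \<Rightarrow> long_ray \<Rightarrow> bool" where
  "x < y \<longleftrightarrow> (case (Rep_long_ray x, Rep_long_ray y) of
     ((a, s), (b, t)) \<Rightarrow> a < b \<or> a = b \<and> s < t)"

instance
  by intro_classes
    (auto simp: less_eq_long_ray_def less_long_ray_def Rep_long_ray_inject[symmetric]
      split: prod.splits)

end

instantiation long_ray :: linorder_topology
begin

definition open_long_ray :: "long_ray set \<Rightarrow> bool" where
  "open_long_ray = generate_topology (range lessThan \<union> range greaterThan)"

instance
  by intro_classes (simp add: open_long_ray_def)

end

definition ray_of_omega1 :: "omega1 \<Rightarrow> long_ray" where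
  "ray_of_omega1 a = Abs_long_ray (a, 0)"

instantiation long_ray :: "{zero, one}"
begin

definition zero_long_ray :: long_ray where "0 = ray_of_omega1 0"

definition one_long_ray :: long_ray where "1 = ray_of_omega1 1"

instance ..

end

lemma long_ray_zero_le [simp]: "(0 :: long_ray) \<le> x"
  unfolding zero_long_ray_def ray_of_omega1_def less_eq_long_ray_def
  using Rep_long_ray[of x] omega1_zero_le
  by (auto simp: Abs_long_ray_inverse order.order_iff_strict split: prod.splits)

lemma long_ray_zero_less_one [simp]: "(0 :: long_ray) < 1"
  by (simp add: zero_long_ray_def one_long_ray_def ray_of_omega1_def less_long_ray_def
      Abs_long_ray_inverse)


section \<open>The long line\<close>

text \<open>
  \<open>Inl x\<close> stands for \<open>- x\<close> in the reflected ray and \<open>Inr x\<close> for \<open>x\<close> in the long ray.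
  The identification of \<open>- 0\<close> with \<open>0\<close> is realised by keeping only the representative \<open>Inr 0\<close>.
\<close>

typedef long_line = "- {Inl 0} :: (long_ray + long_ray) set"
  by (rule exI[of _ "Inr 0"]) simp

definition line_of_ray :: "long_ray \<Rightarrow> long_line" where
  "line_of_ray x = Abs_long_line (Inr x)"

instantiation long_line :: linorder
begin

definition less_eq_long_line :: "long_line \<Rightarrow> long_line \<Rightarrow> bool" where
  "p \<le> q \<longleftrightarrow> (case (Rep_long_line p, Rep_long_line q) of
     (Inl x, Inl y) \<Rightarrow> y \<le> x
   | (Inl x, Inr y) \<Rightarrow> True
   | (Inr x, Inl y) \<Rightarrow> False
   | (Inr x, Inr y) \<Rightarrow> x \<le> y)"

definition less_long_line :: "long_line \<Rightarrow> long_line \<Rightarrow> bool" where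
  "(p :: long_line) < q \<longleftrightarrow> p \<le> q \<and> \<not> q \<le> p"

instance
  by intro_classes
    (auto simp: less_eq_long_line_def less_long_line_def Rep_long_line_inject[symmetric]
      split: sum.splits)

end

instantiation long_line :: linorder_topology
begin

definition open_long_line :: "long_line set \<Rightarrow> bool" where
  "open_long_line = generate_topology (range lessThan \<union> range greaterThan)"

instance
  by intro_classes (simp add: open_long_line_def)

end

instantiation long_line :: "{zero, one, uminus}"
begin

definition zero_long_line :: long_line where "0 = line_of_ray 0"

definition one_long_line :: long_line where "1 = line_of_ray 1"

definition uminus_long_line :: "long_line \<Rightarrow> long_line" where
  "- p = (case Rep_long_line p of
     Inl x \<Rightarrow> line_of_ray x
   | Inr x \<Rightarrow> if x = 0 then 0 else Abs_long_line (Inl x))"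

instance ..

end

lemma long_line_zero_less_one [simp]: "(0 :: long_line) < 1"
  using long_ray_zero_less_one
  by (simp add: zero_long_line_def one_long_line_def line_of_ray_def less_long_line_def
      less_eq_long_line_def Abs_long_line_inverse del: long_ray_zero_less_one)

lemma long_line_minus_one_less_zero [simp]: "- 1 < (0 :: long_line)"
proof -
  have "(1 :: long_ray) \<noteq> 0" using long_ray_zero_less_one by (metis less_irrefl)
  then show ?thesis
    by (simp add: zero_long_line_def one_long_line_def line_of_ray_def less_long_line_def
        less_eq_long_line_def uminus_long_line_def Abs_long_line_inverse)
qed

definition closed_interval :: "'a::linorder_topology set \<Rightarrow> bool" where
  "closed_interval J \<longleftrightarrow>
     closed J \<and> (\<forall>x\<in>J. \<forall>y\<in>J. {x..y} \<subseteq> J) \<and> (\<exists>x\<in>J. \<exists>y\<in>J. x \<noteq> y)"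


section \<open>Compactifications\<close>

definition alpha_ray :: "long_ray option topology" where
  "alpha_ray = Alexandroff_compactification euclidean"

instantiation extended :: (linorder) linorder_topology
begin

definition open_extended :: "'a extended set \<Rightarrow> bool" where
  "open_extended = generate_topology (range lessThan \<union> range greaterThan)"

instance
  by intro_classes (simp add: open_extended_def)

end

definition gamma_line :: "long_line extended topology" where
  "gamma_line = euclidean"


section \<open>Identification spaces\<close>

definition quotient_topology :: "'a topology \<Rightarrow> ('a \<times> 'a) set \<Rightarrow> 'a set topology" where
  "quotient_topology X E = topology (\<lambda>U. U \<subseteq> topspace X // E \<and> openin X (\<Union> U))"

text \<open>
  The points of the topological space \<open>X\<close> are identified along the smallest equivalence relation
  on its carrier that contains \<open>P\<close>.
\<close>

definition identify :: "'a topology \<Rightarrow> ('a \<times> 'a) set \<Rightarrow> 'a set topology" where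
  "identify X P = quotient_topology X (Restr ((P \<union> P\<inverse>)\<^sup>*) (topspace X))"

lemma equiv_identify:
  "equiv (topspace X) (Restr ((P \<union> P\<inverse>)\<^sup>*) (topspace X))"
proof (rule equivI)
  have "sym ((P \<union> P\<inverse>)\<^sup>*)" by (intro sym_rtrancl sym_Un_converse)
  then show "sym (Restr ((P \<union> P\<inverse>)\<^sup>*) (topspace X))" by (auto simp: sym_def)
  show "trans (Restr ((P \<union> P\<inverse>)\<^sup>*) (topspace X))" by (auto intro!: transI)
qed (auto simp: refl_on_def)

lemma openin_quotient_topology:
  assumes "equiv (topspace X) E"
  shows "openin (quotient_topology X E) U \<longleftrightarrow> U \<subseteq> topspace X // E \<and> openin X (\<Union> U)"
proof -
  have Int: "\<Union> (S \<inter> T) = \<Union> S \<inter> \<Union> T" if "S \<subseteq> topspace X // E" "T \<subseteq> topspace X // E" for S T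
  proof
    show "\<Union> S \<inter> \<Union> T \<subseteq> \<Union> (S \<inter> T)"
    proof
      fix x assume "x \<in> \<Union> S \<inter> \<Union> T"
      then obtain A B where "A \<in> S" "B \<in> T" "x \<in> A" "x \<in> B" by blast
      moreover from this have "A = B"
        using that quotient_disj[OF assms, of A B] by blast
      ultimately show "x \<in> \<Union> (S \<inter> T)" by blast
    qed
  qed blast
  have "istopology (\<lambda>U. U \<subseteq> topspace X // E \<and> openin X (\<Union> U))"
    unfolding istopology_def
  proof (intro conjI allI impI)
    fix S T
    assume S: "S \<subseteq> topspace X // E \<and> openin X (\<Union> S)" and T: "T \<subseteq> topspace X // E \<and> openin X (\<Union> T)"
    show "S \<inter> T \<subseteq> topspace X // E" using S by blast
    show "openin X (\<Union> (S \<inter> T))" using S T Int by (simp add: openin_Int)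
  next
    fix \<K> assume K: "\<forall>K\<in>\<K>. K \<subseteq> topspace X // E \<and> openin X (\<Union> K)"
    show "\<Union> \<K> \<subseteq> topspace X // E" using K by blast
    have "\<Union> (\<Union> \<K>) = \<Union> (Union ` \<K>)" by blast
    then show "openin X (\<Union> (\<Union> \<K>))" using K by (metis (no_types, lifting) imageE openin_Union)
  qed
  then show ?thesis
    unfolding quotient_topology_def by (simp add: topology_inverse')
qed


section \<open>The continua of the classification\<close>

definition long_circle :: "long_ray option set topology" where
  "long_circle = identify alpha_ray {(None, Some 0)}"

definition long_lollipop :: "long_ray \<Rightarrow> long_ray option set topology" where
  "long_lollipop p = identify alpha_ray {(None, Some p)}"

definition long_dumbbell :: "long_line extended set topology" where
  "long_dumbbell = identify gamma_line {(Minf, Fin (- 1)), (Pinf, Fin 1)}"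

definition long_figure_eight :: "long_line extended set topology" where
  "long_figure_eight = identify gamma_line {(Minf, Fin 0), (Pinf, Fin 0)}"

definition long_theta_curve :: "long_line extended set topology" where
  "long_theta_curve = identify gamma_line {(Minf, Fin 1), (Pinf, Fin (- 1))}"


section \<open>Continua and \<open>\<aleph>\<^sub>0\<close>-arc connectedness\<close>

definition continuum :: "'a topology \<Rightarrow> bool" where
  "continuum X \<longleftrightarrow> compact_space X \<and> connected_space X \<and> Hausdorff_space X"

definition is_arc :: "'a topology \<Rightarrow> bool" where
  "is_arc X \<longleftrightarrow> X homeomorphic_space top_of_set {0..1 :: real}"

definition aleph0_ac :: "'a topology \<Rightarrow> bool" where
  "aleph0_ac X \<longleftrightarrow>
     (\<forall>S. S \<subseteq> topspace X \<and> countable S \<longrightarrow>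
        (\<exists>A. A \<subseteq> topspace X \<and> is_arc (subtopology X A) \<and> S \<subseteq> A))"

end

theory Submission
  imports Defs
begin

text \<open>
  An \<open>\<aleph>\<^sub>0\<close>-arc connected continuum \<open>K\<close> carries a linear order: fix points \<open>a \<noteq> b\<close> and orient every arc
  containing both so that \<open>a\<close> precedes \<open>b\<close>. Arcs containing \<open>a\<close> and \<open>b\<close> are directed under inclusion, and a
  subarc is order-convex in a larger arc, so these orders fit together. Every segment of \<open>K\<close> is then a copy of
  \<open>[0, 1]\<close>, and every countable subset lies in a segment; hence each end of \<open>K\<close> is either an
  endpoint or long. A linear order with these properties, a least element and no greatest one is isomorphic to the
  long ray: put \<open>g \<alpha> = sup {s (g \<beta>) | \<beta> < \<alpha>}\<close>, where \<open>s\<close> is any map with \<open>s x > x\<close>; the half-open segments from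
  \<open>g \<alpha>\<close> to \<open>s (g \<alpha>)\<close> partition the order. So \<open>K\<close> is a continuous bijective image of an arc, the long ray or the long line.
  A continuous map from the long ray into a compact Hausdorff space has a limit at infinity, because two
  closed unbounded sets meet, and the limit points determine which of the identifications \<open>K\<close> is.
\<close>

section \<open>Order isomorphisms\<close>

text \<open>\<open>K\<close> has a carrier set and no type-class order, so orders are relations on a
  carrier, and statements about a lower end follow from those about an upper end by flipping the
  relation. The obstacle is that the topology of \<open>K\<close> need not be the order topology:
  where a long end accumulates, every neighbourhood contains a whole tail. Only segments are known
  to be arcs, so continuity is checked on segments and then pasted. Directedness of the arcs rests
  on separability: a countable dense subset determines an arc, so the hypothesis on countable sets
  can put two whole arcs into a third. Two closed unbounded subsets of the ray meet because
  alternating points of them have a common supremum; so a closed neighbourhood and the complement of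
  a larger open one cannot both be visited cofinally, and a finite cover gives the limit. The
  constants \<open>0\<close>, \<open>1\<close> and \<open>- 1\<close> in the list are a
  normalisation: the long line has an order automorphism carrying any pair u < v to any other such
  pair, so only the relative position of the two limit points matters.\<close>

definition linear_on :: "'a set \<Rightarrow> ('a \<Rightarrow> 'a \<Rightarrow> bool) \<Rightarrow> bool" where
  "linear_on A le \<longleftrightarrow> (\<forall>x\<in>A. le x x) \<and>
     (\<forall>x\<in>A. \<forall>y\<in>A. \<forall>z\<in>A. le x y \<longrightarrow> le y z \<longrightarrow> le x z) \<and>
     (\<forall>x\<in>A. \<forall>y\<in>A. le x y \<longrightarrow> le y x \<longrightarrow> x = y) \<and> (\<forall>x\<in>A. \<forall>y\<in>A. le x y \<or> le y x)"

definition order_iso :: "'a set \<Rightarrow> ('a \<Rightarrow> 'a \<Rightarrow> bool) \<Rightarrow> 'b set \<Rightarrow> ('b \<Rightarrow> 'b \<Rightarrow> bool) \<Rightarrow> ('a \<Rightarrow> 'b) \<Rightarrow> bool"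
  where "order_iso A le B le' f \<longleftrightarrow> bij_betw f A B \<and> (\<forall>x\<in>A. \<forall>y\<in>A. le x y \<longleftrightarrow> le' (f x) (f y))"

definition seg :: "'a set \<Rightarrow> ('a \<Rightarrow> 'a \<Rightarrow> bool) \<Rightarrow> 'a \<Rightarrow> 'a \<Rightarrow> 'a set" where
  "seg A le x y = {z\<in>A. le x z \<and> le z y}"

definition locally_real :: "'a set \<Rightarrow> ('a \<Rightarrow> 'a \<Rightarrow> bool) \<Rightarrow> bool" where
  "locally_real A le \<longleftrightarrow>
     (\<forall>x\<in>A. \<forall>y\<in>A. le x y \<and> x \<noteq> y \<longrightarrow> (\<exists>k. order_iso {0..1::real} (\<le>) (seg A le x y) le k))"

text \<open>Uncountable cofinality. Strictness of the bound excludes a greatest element, and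
  \<open>C = {}\<close> yields a point of \<open>A\<close>; a long lower end is expressed by the
  flipped relation.\<close>

definition long_right :: "'a set \<Rightarrow> ('a \<Rightarrow> 'a \<Rightarrow> bool) \<Rightarrow> bool" where
  "long_right A le \<longleftrightarrow> (\<forall>C. C \<subseteq> A \<and> countable C \<longrightarrow> (\<exists>u\<in>A. \<forall>c\<in>C. le c u \<and> c \<noteq> u))"

lemma linear_onD:
  assumes "linear_on A le"
  shows "x \<in> A \<Longrightarrow> le x x"
    and "x \<in> A \<Longrightarrow> y \<in> A \<Longrightarrow> z \<in> A \<Longrightarrow> le x y \<Longrightarrow> le y z \<Longrightarrow> le x z"
    and "x \<in> A \<Longrightarrow> y \<in> A \<Longrightarrow> le x y \<Longrightarrow> le y x \<Longrightarrow> x = y"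
    and "x \<in> A \<Longrightarrow> y \<in> A \<Longrightarrow> le x y \<or> le y x"
  using assms unfolding linear_on_def by blast+

lemma linear_onI:
  assumes "\<And>x. x \<in> A \<Longrightarrow> le x x"
    and "\<And>x y z. x \<in> A \<Longrightarrow> y \<in> A \<Longrightarrow> z \<in> A \<Longrightarrow> le x y \<Longrightarrow> le y z \<Longrightarrow> le x z"
    and "\<And>x y. x \<in> A \<Longrightarrow> y \<in> A \<Longrightarrow> le x y \<Longrightarrow> le y x \<Longrightarrow> x = y"
    and "\<And>x y. x \<in> A \<Longrightarrow> y \<in> A \<Longrightarrow> le x y \<or> le y x"
  shows "linear_on A le"
  using assms unfolding linear_on_def by blast

lemma linear_on_linorder [simp]: "linear_on (A :: 'a::linorder set) (\<le>)"
  by (rule linear_onI) auto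

lemma linear_on_dual: "linear_on A le \<Longrightarrow> linear_on A (\<lambda>x y. le y x)"
  by (rule linear_onI) (auto dest: linear_onD)

lemma linear_on_subset:
  assumes "linear_on A le" "B \<subseteq> A"
  shows "linear_on B le"
proof (rule linear_onI)
  note A = linear_onD[OF assms(1)] and B = subsetD[OF assms(2)]
  show "le x x" if "x \<in> B" for x using A(1) B that by simp
  show "le x z" if "x \<in> B" "y \<in> B" "z \<in> B" "le x y" "le y z" for x y z
    using A(2)[of x y z] B that by simp
  show "x = y" if "x \<in> B" "y \<in> B" "le x y" "le y x" for x y
    using A(3)[of x y] B that by simp
  show "le x y \<or> le y x" if "x \<in> B" "y \<in> B" for x y using A(4)[of x y] B that by simp
qed

lemma order_iso_bij: "order_iso A le B le' f \<Longrightarrow> bij_betw f A B"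
  by (simp add: order_iso_def)

lemma order_iso_mem: "order_iso A le B le' f \<Longrightarrow> x \<in> A \<Longrightarrow> f x \<in> B"
  by (auto simp: order_iso_def bij_betw_def)

lemma order_iso_image: "order_iso A le B le' f \<Longrightarrow> f ` A = B"
  by (auto simp: order_iso_def bij_betw_def)

lemma order_iso_inj: "order_iso A le B le' f \<Longrightarrow> inj_on f A"
  by (auto simp: order_iso_def bij_betw_def)

lemma order_iso_le: "order_iso A le B le' f \<Longrightarrow> x \<in> A \<Longrightarrow> y \<in> A \<Longrightarrow> le' (f x) (f y) \<longleftrightarrow> le x y"
  by (auto simp: order_iso_def)

lemma order_iso_eq: "order_iso A le B le' f \<Longrightarrow> x \<in> A \<Longrightarrow> y \<in> A \<Longrightarrow> f x = f y \<longleftrightarrow> x = y"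
  by (auto simp: order_iso_def bij_betw_def inj_on_def)

text \<open>Any two points of the source are comparable, so strict monotonicity alone forces
  injectivity and reflection of the order.\<close>

lemma order_isoI:
  assumes A: "linear_on A le" and B: "linear_on B le'"
    and f: "\<And>x y. x \<in> A \<Longrightarrow> y \<in> A \<Longrightarrow> le x y \<Longrightarrow> x \<noteq> y \<Longrightarrow> le' (f x) (f y) \<and> f x \<noteq> f y"
    and im: "f ` A = B"
  shows "order_iso A le B le' f"
  unfolding order_iso_def bij_betw_def
proof (intro conjI ballI im)
  show "inj_on f A"
    by (rule inj_onI) (metis f linear_onD(4)[OF A])
  fix x y assume xy: "x \<in> A" "y \<in> A"
  then have "f x \<in> B" "f y \<in> B" using im by auto
  then show "le x y \<longleftrightarrow> le' (f x) (f y)"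
    using f xy linear_onD(1,3)[OF B] linear_onD(1,4)[OF A] by metis
qed

lemma order_iso_comp:
  assumes "order_iso A le B le' f" "order_iso B le' C le'' g"
  shows "order_iso A le C le'' (g \<circ> f)"
  using assms bij_betw_trans[of f A B g C] order_iso_mem[OF assms(1)]
  by (auto simp: order_iso_def)

lemma order_iso_inv:
  assumes "order_iso A le B le' f"
  shows "order_iso B le' A le (inv_into A f)"
proof -
  have "f (inv_into A f y) = y" "inv_into A f y \<in> A" if "y \<in> B" for y
    using that order_iso_image[OF assms] by (auto simp: f_inv_into_f inv_into_into)
  then show ?thesis
    using assms bij_betw_inv_into[OF order_iso_bij[OF assms]] unfolding order_iso_def by metis
qed

lemma order_iso_dual:
  "order_iso A le B le' f \<Longrightarrow> order_iso A (\<lambda>x y. le y x) B (\<lambda>x y. le' y x) f"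
  by (auto simp: order_iso_def)

lemma order_iso_subset:
  "order_iso A le B le' f \<Longrightarrow> C \<subseteq> A \<Longrightarrow> order_iso C le (f ` C) le' f"
  by (auto simp: order_iso_def bij_betw_def inj_on_subset subset_iff)

lemma order_iso_seg:
  assumes "order_iso A le B le' f" "x \<in> A" "y \<in> A"
  shows "order_iso (seg A le x y) le (seg B le' (f x) (f y)) le' f"
proof -
  have "f ` seg A le x y = seg B le' (f x) (f y)"
    using order_iso_image[OF assms(1)] order_iso_le[OF assms(1)] assms(2,3)
    by (auto simp: seg_def)
  then show ?thesis using order_iso_subset[OF assms(1), of "seg A le x y"] by (auto simp: seg_def)
qed

text \<open>The halves share only \<open>c\<close>. It is the greatest point of one and the least of
  the other, so both maps must send it to \<open>d\<close> and they agree there.\<close>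

lemma order_iso_glue:
  assumes A: "linear_on A le" and B: "linear_on B le'" and c: "c \<in> A" and d: "d \<in> B"
    and f: "order_iso {x\<in>A. le x c} le {y\<in>B. le' y d} le' f"
    and g: "order_iso {x\<in>A. le c x} le {y\<in>B. le' d y} le' g"
  obtains h where "order_iso A le B le' h"
    "\<And>x. x \<in> A \<Longrightarrow> le x c \<Longrightarrow> h x = f x" "\<And>x. x \<in> A \<Longrightarrow> le c x \<Longrightarrow> h x = g x" "h c = d"
proof -
  note A' = linear_onD[OF A] and B' = linear_onD[OF B]
  have fc: "f c = d"
  proof -
    obtain z where z: "z \<in> A" "le z c" "f z = d"
    proof -
      have "d \<in> f ` {x\<in>A. le x c}" using order_iso_image[OF f] d B'(1)[OF d] by simp
      then show ?thesis using that by blast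
    qed
    have "le' (f z) (f c)" using order_iso_le[OF f, of z c] z c A'(1) by auto
    moreover have "f c \<in> B" "le' (f c) d" using order_iso_mem[OF f, of c] c A'(1) by auto
    ultimately show ?thesis using z B'(3) d by metis
  qed
  have gc: "g c = d"
  proof -
    obtain z where z: "z \<in> A" "le c z" "g z = d"
    proof -
      have "d \<in> g ` {x\<in>A. le c x}" using order_iso_image[OF g] d B'(1)[OF d] by simp
      then show ?thesis using that by blast
    qed
    have "le' (g c) (g z)" using order_iso_le[OF g, of c z] z c A'(1) by auto
    moreover have "g c \<in> B" "le' d (g c)" using order_iso_mem[OF g, of c] c A'(1) by auto
    ultimately show ?thesis using z B'(3) d by metis
  qed
  define h where "h x = (if le x c then f x else g x)" for x
  have hf: "h x = f x" if "x \<in> A" "le x c" for x using that by (simp add: h_def)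
  have hg: "h x = g x" if "x \<in> A" "le c x" for x
    using that A'(3)[OF that(1) c] fc gc by (auto simp: h_def)
  have hfm: "h x \<in> B" "le' (h x) d" if "x \<in> A" "le x c" for x
    using order_iso_mem[OF f, of x] hf that by auto
  have hgm: "h x \<in> B" "le' d (h x)" if "x \<in> A" "le c x" for x
    using order_iso_mem[OF g, of x] hg that by auto
  have "order_iso A le B le' h"
  proof (rule order_isoI[OF A B])
    show "h ` A = B"
    proof
      show "h ` A \<subseteq> B" using A'(4)[OF _ c] hfm hgm by blast
      show "B \<subseteq> h ` A"
      proof
        fix y assume y: "y \<in> B"
        show "y \<in> h ` A"
        proof (cases "le' y d")
          case True
          then have "y \<in> f ` {x\<in>A. le x c}" using y order_iso_image[OF f] by auto
          then obtain x where "x \<in> A" "le x c" "y = f x" by auto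
          then show ?thesis using hf by (metis imageI)
        next
          case False
          then have "y \<in> g ` {x\<in>A. le c x}" using y order_iso_image[OF g] B'(4)[OF y d] by auto
          then obtain x where "x \<in> A" "le c x" "y = g x" by auto
          then show ?thesis using hg by (metis imageI)
        qed
      qed
    qed
    fix x y assume xy: "x \<in> A" "y \<in> A" "le x y" "x \<noteq> y"
    consider "le y c" | "le c x" | "le x c" "le c y" "\<not> le y c" "\<not> le c x"
      using A'(4) c xy by metis
    then show "le' (h x) (h y) \<and> h x \<noteq> h y"
    proof cases
      case 1
      then have "le x c" using A'(2)[of x y c] xy c by blast
      with 1 show ?thesis using order_iso_le[OF f, of x y] order_iso_eq[OF f, of x y] xy hf by auto
    next
      case 2
      then have "le c y" using A'(2)[of c x y] xy c by blast
      with 2 show ?thesis using order_iso_le[OF g, of x y] order_iso_eq[OF g, of x y] xy hg by auto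
    next
      case 3
      have 1: "le' (h x) (h y)" using B'(2)[of "h x" d "h y"] hfm[of x] hgm[of y] xy 3 d by blast
      have "h x \<noteq> h y"
      proof
        assume "h x = h y"
        then have "h x = d" using hfm[of x] hgm[of y] B'(3)[of "h x" d] d 3 xy by auto
        then have "f x = f c" using hf fc 3 xy by metis
        then show False using order_iso_eq[OF f, of x c] 3 xy c A'(1) by auto
      qed
      then show ?thesis using 1 by blast
    qed
  qed
  then show thesis using that[of h] hf hg hf[OF c A'(1)[OF c]] fc by metis
qed

text \<open>As a rewrite rule with uninstantiated \<open>le\<close> this loops.\<close>

lemma seg_dual: "seg A (\<lambda>x y. le y x) x y = seg A le y x"
  by (auto simp: seg_def)

lemma seg_linorder [simp]: "seg UNIV (\<le>) x y = {x..y :: 'a::linorder}"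
  by (auto simp: seg_def)

section \<open>Segments isomorphic to the real unit interval\<close>

lemma order_iso_real_interval:
  fixes a b :: real
  assumes "a < b"
  shows "order_iso {0..1::real} (\<le>) {a..b} (\<le>) (\<lambda>t. a + t * (b - a))"
proof (rule order_isoI)
  show "(\<lambda>t. a + t * (b - a)) ` {0..1} = {a..b}"
  proof (intro equalityI subsetI)
    fix y assume "y \<in> {a..b}"
    then show "y \<in> (\<lambda>t. a + t * (b - a)) ` {0..1}"
      using assms by (intro image_eqI[of _ _ "(y - a) / (b - a)"]) auto
  next
    fix y assume "y \<in> (\<lambda>t. a + t * (b - a)) ` {0..1}"
    then obtain t where t: "0 \<le> t" "t \<le> 1" and y: "y = a + t * (b - a)" by auto
    have "t * (b - a) \<le> b - a" "0 \<le> t * (b - a)" using t assms by (simp_all add: mult_left_le_one_le)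
    then show "y \<in> {a..b}" using y by auto
  qed
qed (use assms in auto)

lemma order_iso_unit_interval:
  fixes a b :: real
  assumes "a < b" and "order_iso {a..b} (\<le>) A le k"
  obtains k' where "order_iso {0..1::real} (\<le>) A le k'"
  using order_iso_comp[OF order_iso_real_interval[OF assms(1)] assms(2)] by (rule that)

lemma order_iso_unit_ends:
  assumes "linear_on A le" "x \<in> A" "y \<in> A" "le x y"
    and "order_iso {a..b::real} (\<le>) (seg A le x y) le k" "a \<le> b"
  shows "k a = x" "k b = y"
proof -
  note A' = linear_onD[OF assms(1)] and k = assms(5)
  have x: "x \<in> seg A le x y" and y: "y \<in> seg A le x y" using assms A'(1) by (auto simp: seg_def)
  then obtain s t where st: "s \<in> {a..b}" "k s = x" "t \<in> {a..b}" "k t = y"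
    using order_iso_image[OF k] by (metis imageE)
  have m: "k a \<in> seg A le x y" "k b \<in> seg A le x y" using order_iso_mem[OF k] assms(6) by auto
  have "le (k a) x" "le y (k b)"
    using order_iso_le[OF k, of a s] order_iso_le[OF k, of t b] st assms(6) by auto
  with m show "k a = x" "k b = y"
    using assms(2,3) A'(3) by (auto simp: seg_def)
qed

lemma locally_realD:
  assumes "locally_real A le" "x \<in> A" "y \<in> A" "le x y" "x \<noteq> y"
  obtains k where "order_iso {0..1::real} (\<le>) (seg A le x y) le k"
proof -
  have "\<exists>k. order_iso {0..1::real} (\<le>) (seg A le x y) le k"
    using assms(1)[unfolded locally_real_def, rule_format, of x y] assms(2-5) by simp
  then show ?thesis by (elim exE) (rule that)
qed

lemma order_iso_flip: "order_iso {0..1::real} (\<le>) {0..1} (\<ge>) (\<lambda>t. 1 - t)"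
proof (rule order_isoI)
  show "(\<lambda>t. 1 - t) ` {0..1::real} = {0..1}"
    using image_diff_atLeastAtMost[of 1 0 "1::real"] by simp
qed (auto intro: linear_onI)

lemma locally_real_dual:
  assumes "locally_real A le"
  shows "locally_real A (\<lambda>x y. le y x)"
  unfolding locally_real_def seg_dual[of A le]
proof (intro ballI impI)
  fix x y assume xy: "x \<in> A" "y \<in> A" "le y x \<and> x \<noteq> y"
  obtain k where k: "order_iso {0..1::real} (\<le>) (seg A le y x) le k"
    by (rule locally_realD[OF assms xy(2,1) xy(3)[THEN conjunct1] xy(3)[THEN conjunct2, symmetric]])
  from order_iso_comp[OF order_iso_flip order_iso_dual[OF k]]
  show "\<exists>k. order_iso {0..1::real} (\<le>) (seg A le y x) (\<lambda>x y. le y x) k" by blast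
qed

lemma locally_real_subset:
  assumes "locally_real A le" "B \<subseteq> A"
    and "\<And>x y z. x \<in> B \<Longrightarrow> y \<in> B \<Longrightarrow> z \<in> A \<Longrightarrow> le x z \<Longrightarrow> le z y \<Longrightarrow> z \<in> B"
  shows "locally_real B le"
  unfolding locally_real_def
proof (intro ballI impI)
  fix x y assume xy: "x \<in> B" "y \<in> B" "le x y \<and> x \<noteq> y"
  then have "seg B le x y = seg A le x y" 
    using assms(2) assms(3)[OF xy(1,2)] unfolding seg_def by blast
  moreover obtain k where "order_iso {0..1::real} (\<le>) (seg A le x y) le k"
    by (rule locally_realD[OF assms(1) assms(2)[THEN subsetD, OF xy(1)] assms(2)[THEN subsetD, OF xy(2)]
        xy(3)[THEN conjunct1] xy(3)[THEN conjunct2]])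
  ultimately show "\<exists>k. order_iso {0..1::real} (\<le>) (seg B le x y) le k" by (metis (no_types))
qed

lemma locally_real_iso:
  assumes "order_iso A le B le' f" "locally_real A le"
  shows "locally_real B le'"
  unfolding locally_real_def
proof (intro ballI impI)
  fix x y assume xy: "x \<in> B" "y \<in> B" "le' x y \<and> x \<noteq> y"
  then obtain u v where uv: "u \<in> A" "v \<in> A" "x = f u" "y = f v"
    using order_iso_image[OF assms(1)] by (metis imageE)
  then have "le u v" "u \<noteq> v" using xy order_iso_le[OF assms(1), of u v] by auto
  then obtain k where k: "order_iso {0..1::real} (\<le>) (seg A le u v) le k"
    by (rule locally_realD[OF assms(2) uv(1,2)])
  from order_iso_comp[OF k order_iso_seg[OF assms(1) uv(1,2)]]
  show "\<exists>k. order_iso {0..1::real} (\<le>) (seg B le' x y) le' k" unfolding uv by blast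
qed

text \<open>A segment crossing \<open>c\<close> is a copy of \<open>{0..1}\<close> followed by a
  copy of \<open>{1..2}\<close>; the glued copy of \<open>{0..2}\<close> is rescaled.\<close>

lemma locally_real_glue:
  assumes A: "linear_on A le" and c: "c \<in> A"
    and lower: "locally_real {x\<in>A. le x c} le" and upper: "locally_real {x\<in>A. le c x} le"
  shows "locally_real A le"
  unfolding locally_real_def
proof (intro ballI impI)
  note A' = linear_onD[OF A]
  fix x y assume xy: "x \<in> A" "y \<in> A" "le x y \<and> x \<noteq> y"
  consider "le y c" | "le c x" | "le x c" "le c y" "x \<noteq> c" "y \<noteq> c"
    using A'(4) c xy by metis
  then show "\<exists>k. order_iso {0..1::real} (\<le>) (seg A le x y) le k"
  proof cases
    case 1
    then have "seg A le x y = seg {x\<in>A. le x c} le x y" "x \<in> {x\<in>A. le x c}" "y \<in> {x\<in>A. le x c}"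
      using A'(2) c xy unfolding seg_def by blast+
    moreover obtain k where "order_iso {0..1::real} (\<le>) (seg {x\<in>A. le x c} le x y) le k"
      by (rule locally_realD[OF lower calculation(2,3) xy(3)[THEN conjunct1] xy(3)[THEN conjunct2]])
    ultimately show ?thesis by (metis (no_types))
  next
    case 2
    then have "seg A le x y = seg {x\<in>A. le c x} le x y" "x \<in> {x\<in>A. le c x}" "y \<in> {x\<in>A. le c x}"
      using A'(2) c xy unfolding seg_def by blast+
    moreover obtain k where "order_iso {0..1::real} (\<le>) (seg {x\<in>A. le c x} le x y) le k"
      by (rule locally_realD[OF upper calculation(2,3) xy(3)[THEN conjunct1] xy(3)[THEN conjunct2]])
    ultimately show ?thesis by (metis (no_types))
  next
    case 3
    have "seg A le x c = seg {x\<in>A. le x c} le x c" "seg A le c y = seg {x\<in>A. le c x} le c y"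
      unfolding seg_def by blast+
    moreover have "x \<in> {x\<in>A. le x c}" "c \<in> {x\<in>A. le x c}" "c \<in> {x\<in>A. le c x}" "y \<in> {x\<in>A. le c x}"
      using 3 c xy A'(1)[OF c] by simp_all
    moreover obtain k1 where "order_iso {0..1::real} (\<le>) (seg {x\<in>A. le x c} le x c) le k1"
      by (rule locally_realD[OF lower calculation(3,4) 3(1,3)])
    moreover obtain k2 where "order_iso {0..1::real} (\<le>) (seg {x\<in>A. le c x} le c y) le k2"
      by (rule locally_realD[OF upper calculation(5,6) 3(2) 3(4)[symmetric]])
    ultimately have k1: "order_iso {0..1::real} (\<le>) (seg A le x c) le k1"
      and k2: "order_iso {0..1::real} (\<le>) (seg A le c y) le k2" by simp_all
    \<comment> \<open>The unsimplified \<open>1 + t * (2 - 1)\<close> is the affine map of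
      \<open>order_iso_real_interval\<close> at the ends \<open>1\<close> and
      \<open>2\<close>.\<close>
    have k3: "order_iso {1..2::real} (\<le>) (seg A le c y) le (k2 \<circ> inv_into {0..1} (\<lambda>t. 1 + t * (2 - 1)))"
      by (rule order_iso_comp[OF order_iso_inv[OF order_iso_real_interval] k2]) simp
    have S: "linear_on (seg A le x y) le"
      by (rule linear_on_subset[OF A]) (auto simp: seg_def)
    have cS: "c \<in> seg A le x y" using 3 c by (simp add: seg_def)
    have e: "{t\<in>{0..2::real}. t \<le> 1} = {0..1}" "{t\<in>{0..2::real}. 1 \<le> t} = {1..2}" by auto
    have "le z y" if "z \<in> A" "le z c" for z using A'(2)[OF that(1) c xy(2) that(2)] 3 by simp
    then have e1: "{z\<in>seg A le x y. le z c} = seg A le x c" unfolding seg_def by blast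
    have "le x z" if "z \<in> A" "le c z" for z using A'(2)[OF xy(1) c that(1) _ that(2)] 3 by simp
    then have e2: "{z\<in>seg A le x y. le c z} = seg A le c y" unfolding seg_def by blast
    obtain h where "order_iso {0..2::real} (\<le>) (seg A le x y) le h"
      using order_iso_glue[OF _ S _ cS, of "{0..2::real}" "(\<le>)" 1, unfolded e e1 e2, OF _ _ k1 k3] by auto
    then show ?thesis by (rule order_iso_unit_interval[rotated]) auto
  qed
qed

section \<open>A characterization of the long ray\<close>

definition is_lub :: "'a set \<Rightarrow> ('a \<Rightarrow> 'a \<Rightarrow> bool) \<Rightarrow> 'a set \<Rightarrow> 'a \<Rightarrow> bool" where
  "is_lub A le C z \<longleftrightarrow> z \<in> A \<and> (\<forall>c\<in>C. le c z) \<and> (\<forall>w\<in>A. (\<forall>c\<in>C. le c w) \<longrightarrow> le z w)"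

text \<open>Fix \<open>m\<close> in \<open>C\<close> and a strict upper bound \<open>u\<close>. The
  segment between them is a copy of the unit interval, where a real supremum is available; points of
  \<open>C\<close> below \<open>m\<close> do not affect it.\<close>

lemma countable_lub_exists:
  assumes A: "linear_on A le" and real: "locally_real A le" and long: "long_right A le"
    and C: "C \<subseteq> A" "countable C" and ne: "C \<noteq> {}"
  obtains z where "is_lub A le C z"
proof -
  note A' = linear_onD[OF A]
  obtain m where m: "m \<in> C" using ne by blast
  obtain u where u: "u \<in> A" "\<And>c. c \<in> C \<Longrightarrow> le c u \<and> c \<noteq> u"
    using long C unfolding long_right_def by metis
  have mA: "m \<in> A" using m C by blast
  obtain k where k: "order_iso {0..1::real} (\<le>) (seg A le m u) le k"
    using locally_realD[OF real mA u(1)] u(2)[OF m] by metis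
  define T where "T = {t\<in>{0..1}. k t \<in> C}"
  have m_seg: "m \<in> seg A le m u" using mA A'(1) u(2)[OF m] by (simp add: seg_def)
  then obtain t0 where t0: "t0 \<in> {0..1}" "k t0 = m" using order_iso_image[OF k] by (metis imageE)
  then have t0T: "t0 \<in> T" using m by (simp add: T_def)
  have bdd: "bdd_above T" unfolding T_def by (rule bdd_aboveI[of _ 1]) auto
  have "Sup T \<le> 1" by (rule cSup_least) (use t0T in \<open>auto simp: T_def\<close>)
  then have S: "Sup T \<in> {0..1}" using cSup_upper[OF t0T bdd] t0(1) by simp
  have kS: "k (Sup T) \<in> A" "le m (k (Sup T))" using order_iso_mem[OF k S] by (auto simp: seg_def)
  have up: "le c (k (Sup T))" if c: "c \<in> C" for c
  proof (cases "le m c")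
    case True
    then have "c \<in> seg A le m u" using c C(1) u(2)[OF c] by (auto simp: seg_def)
    then obtain t where t: "t \<in> {0..1}" "k t = c" using order_iso_image[OF k] by (metis imageE)
    then have "t \<le> Sup T" using c bdd by (intro cSup_upper) (auto simp: T_def)
    then show ?thesis using order_iso_le[OF k t(1) S] t by simp
  next
    case False
    then have "le c m" using A'(4)[of m c] mA c C by blast
    then show ?thesis using A'(2)[of c m "k (Sup T)"] mA c C kS by blast
  qed
  have "le (k (Sup T)) w" if w: "w \<in> A" "\<And>c. c \<in> C \<Longrightarrow> le c w" for w
  proof (cases "le w u")
    case True
    then have "w \<in> seg A le m u" using w m by (auto simp: seg_def)
    then obtain t where t: "t \<in> {0..1}" "k t = w" using order_iso_image[OF k] by (metis imageE)
    have "Sup T \<le> t"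
    proof (rule cSup_least)
      show "T \<noteq> {}" using t0T by blast
      fix s assume "s \<in> T"
      then show "s \<le> t" using w(2) t order_iso_le[OF k, of s t] by (auto simp: T_def)
    qed
    then show ?thesis using order_iso_le[OF k S t(1)] t by simp
  next
    case False
    then have "le u w" using A'(4) u w by blast
    moreover have "le (k (Sup T)) u" using order_iso_mem[OF k S] by (simp add: seg_def)
    ultimately show ?thesis using A'(2)[of "k (Sup T)" u w] kS u w by blast
  qed
  then show ?thesis using kS up that[of "k (Sup T)"] by (auto simp: is_lub_def)
qed

text \<open>The open intervals from \<open>g a\<close> to \<open>s a\<close> are nonempty and
  pairwise disjoint; choosing a rational in each would inject \<open>omega1\<close> into the
  rationals.\<close>

lemma no_strict_chain_omega1:
  fixes g :: "omega1 \<Rightarrow> real"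
  assumes "\<And>a. g a < s a" and "\<And>a b. a < b \<Longrightarrow> s a \<le> g b"
  shows False
proof -
  have "\<exists>q. g a < of_rat q \<and> of_rat q < s a" for a
    using of_rat_dense[OF assms(1)] by blast
  then obtain q where q: "\<And>a. g a < of_rat (q a)" "\<And>a. of_rat (q a) < s a" by metis
  have "inj q"
  proof (rule linorder_injI)
    fix a b :: omega1 assume "a < b"
    then have "s a \<le> g b" by (rule assms)
    then show "q a \<noteq> q b" using q(1)[of b] q(2)[of a] by auto
  qed
  then have "countable (UNIV :: omega1 set)"
    by (rule countable_image_inj_on[rotated]) simp
  then show False using uncountable_omega1 by blast
qed

lemma wf_less_omega1: "wf {(a, b :: omega1). a < b}"
  using wfp_on_less wfp_def by (auto intro: wf)

lemma Rep_long_ray_cases: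
  obtains a t where "x = Abs_long_ray (a, t)" "0 \<le> t" "t < 1"
  by (cases x) auto

lemma Abs_long_ray_le:
  assumes "0 \<le> s" "s < 1" "0 \<le> t" "t < 1"
  shows "Abs_long_ray (a, s) \<le> Abs_long_ray (b, t) \<longleftrightarrow> a < b \<or> a = b \<and> s \<le> t"
    and "Abs_long_ray (a, s) < Abs_long_ray (b, t) \<longleftrightarrow> a < b \<or> a = b \<and> s < t"
    and "Abs_long_ray (a, s) = Abs_long_ray (b, t) \<longleftrightarrow> a = b \<and> s = t"
  using assms by (auto simp: less_eq_long_ray_def less_long_ray_def Abs_long_ray_inverse Abs_long_ray_inject)

text \<open>\<open>L\<close> is total on sets: the recursion is defined first, and an induction
  afterwards shows that its values stay in the carrier, where \<open>L\<close> really returns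
  suprema.\<close>

definition ladder :: "('a \<Rightarrow> 'a) \<Rightarrow> ('a set \<Rightarrow> 'a) \<Rightarrow> omega1 \<Rightarrow> 'a" where
  "ladder s L = wfrec {(a, b). a < b} (\<lambda>g a. L ((\<lambda>b. s (g b)) ` {..<a}))"

lemma ladder: "ladder s L a = L ((\<lambda>b. s (ladder s L b)) ` {..<a})"
proof -
  let ?R = "{(a, b :: omega1). a < b}"
  have "ladder s L a = L ((\<lambda>b. s (cut (ladder s L) ?R a b)) ` {..<a})"
    unfolding ladder_def by (subst wfrec[OF wf_less_omega1]) simp
  also have "(\<lambda>b. s (cut (ladder s L) ?R a b)) ` {..<a} = (\<lambda>b. s (ladder s L b)) ` {..<a}"
    by (rule image_cong) (auto simp: cut_apply)
  finally show ?thesis .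
qed

theorem long_ray_order_iso:
  assumes A: "linear_on A le" and real: "locally_real A le" and long: "long_right A le"
    and m: "m \<in> A" and least: "\<And>x. x \<in> A \<Longrightarrow> le m x"
  obtains h where "order_iso (UNIV :: long_ray set) (\<le>) A le h"
proof -
  note A' = linear_onD[OF A]
  have "\<exists>y\<in>A. le x y \<and> x \<noteq> y" if "x \<in> A" for x
    using long[unfolded long_right_def, rule_format, of "{x}"] that by auto
  then obtain s where s: "\<And>x. x \<in> A \<Longrightarrow> s x \<in> A \<and> le x (s x) \<and> x \<noteq> s x" by metis
  \<comment> \<open>Adding \<open>m\<close> keeps the set nonempty, so the supremum exists also at
    stage \<open>0\<close>, where it is the least element \<open>m\<close>.\<close>
  have "\<exists>z. is_lub A le (insert m C) z" if "C \<subseteq> A" "countable C" for C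
    using countable_lub_exists[OF A real long, of "insert m C"] that m by blast
  then obtain L where L: "\<And>C. C \<subseteq> A \<Longrightarrow> countable C \<Longrightarrow> is_lub A le (insert m C) (L C)" by metis
  define g where "g = ladder s L"
  have lub: "g a \<in> A \<and> is_lub A le (insert m ((\<lambda>b. s (g b)) ` {..<a})) (g a)" for a
  proof (induction a rule: less_induct)
    case (less a)
    then have "(\<lambda>b. s (g b)) ` {..<a} \<subseteq> A" using s by auto
    then have "is_lub A le (insert m ((\<lambda>b. s (g b)) ` {..<a})) (g a)"
      unfolding g_def by (subst (2) ladder) (intro L countable_image countable_lessThan_omega1)
    then show ?case by (simp add: is_lub_def)
  qed
  have gA: "g a \<in> A" and sgA: "s (g a) \<in> A" for a using lub s by auto
  have step: "le (s (g a)) (g b)" if "a < b" for a b using lub[of b] that by (auto simp: is_lub_def)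
  obtain k where k: "\<And>x. x \<in> A \<Longrightarrow> order_iso {0..1::real} (\<le>) (seg A le x (s x)) le (k x)"
  proof -
    have "\<exists>k. x \<in> A \<longrightarrow> order_iso {0..1::real} (\<le>) (seg A le x (s x)) le k" for x
      using locally_realD[OF real, of x "s x"] s[of x] by metis
    then show ?thesis using that by metis
  qed
  \<comment> \<open>A bound \<open>x\<close> would trap uncountably many successive segments, from
    \<open>g a\<close> to \<open>s (g a)\<close>, in one copy of the unit interval.\<close>
  have unbounded: "\<exists>a. \<not> le (g a) x" if x: "x \<in> A" for x
  proof (rule ccontr)
    assume "\<nexists>a. \<not> le (g a) x"
    then have le: "le (g a) x" for a by blast
    \<comment> \<open>Initial segments of \<open>omega1\<close> are countable, so it has no greatest
      element; hence each \<open>s (g a)\<close> lies below some later \<open>g b\<close>, and so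
      below \<open>x\<close>.\<close>
    have "\<exists>b. a < b" for a :: omega1
    proof (rule ccontr)
      assume "\<nexists>b. a < b"
      then have "UNIV = insert a {..<a}" by (auto simp: not_less order_le_less)
      then show False using uncountable_omega1 countable_lessThan_omega1[of a] by (metis countable_insert)
    qed
    then have sle: "le (s (g a)) x" for a
      using step[of a] A'(2)[of "s (g a)" _ x] gA sgA le x by metis
    have ne: "m \<noteq> x"
    proof
      assume "m = x"
      then have "s (g 0) = m" "g 0 = m" using le[of 0] sle[of 0] least gA[of 0] sgA[of 0] m A'(3) by auto
      then show False using s[OF gA[of 0]] by simp
    qed
    obtain k where k: "order_iso {0..1::real} (\<le>) (seg A le m x) le k"
      using locally_realD[OF real m x least[OF x] ne] by metis
    let ?f = "inv_into {0..1} k"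
    note f = order_iso_inv[OF k]
    have seg: "g a \<in> seg A le m x" "s (g a) \<in> seg A le m x" for a
      using gA sgA le sle least by (auto simp: seg_def)
    show False
    proof (rule no_strict_chain_omega1)
      show "?f (g a) < ?f (s (g a))" for a
        using order_iso_le[OF f seg(1)[of a] seg(2)[of a]] order_iso_eq[OF f seg(1)[of a] seg(2)[of a]]
          s[OF gA[of a]] by simp
      show "?f (s (g a)) \<le> ?f (g b)" if "a < b" for a b
        using order_iso_le[OF f seg(2)[of a] seg(1)[of b]] step[OF that] by simp
    qed
  qed
  define h where "h x = (case Rep_long_ray x of (a, t) \<Rightarrow> k (g a) t)" for x
  have h: "h (Abs_long_ray (a, t)) = k (g a) t" if "0 \<le> t" "t < 1" for a t
    using that by (simp add: h_def Abs_long_ray_inverse)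
  have k0: "k (g a) 0 = g a" and k1: "k (g a) 1 = s (g a)" for a
    using order_iso_unit_ends[OF A gA sgA _ k[OF gA]] s[OF gA] by auto
  have kA: "k (g a) t \<in> A" "le (g a) (k (g a) t)" "le (k (g a) t) (s (g a))" if "0 \<le> t" "t \<le> 1" for a t
    using order_iso_mem[OF k[OF gA], of t a] that by (auto simp: seg_def)
  have kless: "k (g a) t \<noteq> s (g a)" if "0 \<le> t" "t < 1" for a t
    using order_iso_eq[OF k[OF gA], of t 1 a] k1 that by auto
  have "order_iso (UNIV :: long_ray set) (\<le>) A le h"
  proof (rule order_isoI[OF linear_on_linorder A])
    fix x y :: long_ray assume xy: "x \<le> y" "x \<noteq> y"
    obtain a t where x: "x = Abs_long_ray (a, t)" "0 \<le> t" "t < 1" by (rule Rep_long_ray_cases)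
    obtain b u where y: "y = Abs_long_ray (b, u)" "0 \<le> u" "u < 1" by (rule Rep_long_ray_cases)
    have hx: "h x = k (g a) t" and hy: "h y = k (g b) u" using h x y by auto
    consider "a < b" | "a = b" "t < u"
      using xy x y Abs_long_ray_le[of t u a b] by (auto simp: order_le_less)
    then show "le (h x) (h y) \<and> h x \<noteq> h y"
    proof cases
      case 1
      have 1: "le (s (g a)) (h y)"
        using A'(2)[OF sgA[of a] gA[of b] _ step[OF 1]] kA(1,2)[of u b] y hy by simp
      have 2: "le (h x) (s (g a))" "h x \<noteq> s (g a)" "h x \<in> A" "h y \<in> A"
        using kA(1,3)[of t a] kA(1)[of u b] kless[of t a] x y hx hy by auto
      show ?thesis using A'(2)[of "h x" "s (g a)" "h y"] A'(3)[of "h x" "s (g a)"] 1 2 sgA by metis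
    next
      case 2
      then show ?thesis
        using order_iso_le[OF k[OF gA[of a]], of t u] order_iso_eq[OF k[OF gA[of a]], of t u] x y hx hy
        by auto
    qed
  next
    have "h x \<in> A" for x
    proof -
      obtain a t where x: "x = Abs_long_ray (a, t)" "0 \<le> t" "t < 1" by (rule Rep_long_ray_cases)
      then show ?thesis using h kA(1) by simp
    qed
    moreover have "z \<in> range h" if z: "z \<in> A" for z
    proof -
      \<comment> \<open>At the first index \<open>a\<close> with \<open>g a\<close> not below
        \<open>z\<close>, the supremum defining \<open>g a\<close> yields an earlier
        \<open>b\<close> whose \<open>s (g b)\<close> already fails to be below \<open>z\<close>. So
        \<open>z\<close> lies in the segment starting at \<open>g b\<close>.\<close>
      define a where "a = (LEAST a. \<not> le (g a) z)"
      have a: "\<not> le (g a) z" unfolding a_def by (rule LeastI_ex) (rule unbounded[OF z])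
      have below: "le (g b) z" if "b < a" for b
        using not_less_Least[of b "\<lambda>a. \<not> le (g a) z"] that by (auto simp: a_def)
      obtain b where b: "b < a" "\<not> le (s (g b)) z"
        using a lub[of a] least[OF z] z unfolding is_lub_def by blast
      then have "z \<in> seg A le (g b) (s (g b))" using below z A'(4)[OF z sgA[of b]] by (auto simp: seg_def)
      then obtain t where t: "t \<in> {0..1}" "k (g b) t = z" using order_iso_image[OF k[OF gA[of b]]] by (metis imageE)
      then have "t \<noteq> 1" using b(2) k1[of b] A'(1)[OF z] by auto
      then show ?thesis using t h[of t b] by (metis atLeastAtMost_iff order_le_less rangeI)
    qed
    ultimately show "range h = A" by auto
  qed
  then show ?thesis by (rule that)
qed

section \<open>The order structure of the long ray and the long line\<close>

lemma countable_summable_weights: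
  assumes "countable X"
  obtains w :: "'a \<Rightarrow> real" where "\<And>x. x \<in> X \<Longrightarrow> 0 < w x" "w summable_on X"
proof
  let ?w = "\<lambda>x. (1/2::real) ^ to_nat_on X x"
  show "0 < ?w x" for x by simp
  have "(\<lambda>n. (1/2::real) ^ n) summable_on UNIV"
    by (rule norm_summable_imp_summable_on) (simp add: summable_geometric_iff)
  then have "(\<lambda>n. (1/2::real) ^ n) summable_on to_nat_on X ` X"
    by (rule summable_on_subset_banach) simp
  then show "?w summable_on X"
    using summable_on_reindex[OF inj_on_to_nat_on[OF assms], of "\<lambda>n. (1/2::real) ^ n"] by (simp add: o_def)
qed

lemma countable_atMost_omega1: "countable {..a :: omega1}"
proof -
  have "{..a} = insert a {..<a}" by auto
  then show ?thesis using countable_lessThan_omega1[of a] by simp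
qed

text \<open>
  Below a countable ordinal \<open>a\<close>, give each ordinal \<open>b\<close> a weight \<open>w b\<close> with finite total weight;
  then \<open>(b, t) \<mapsto> (\<Sum>c<b. w c) + t * w b\<close> embeds an initial segment of the long ray onto an interval.
\<close>

lemma locally_real_long_ray: "locally_real (UNIV :: long_ray set) (\<le>)"
  unfolding locally_real_def seg_linorder
proof (intro ballI impI)
  fix x y :: long_ray assume xy: "x \<le> y \<and> x \<noteq> y"
  obtain a u where y: "y = Abs_long_ray (a, u)" "0 \<le> u" "u < 1" by (rule Rep_long_ray_cases)
  \<comment> \<open>The cell containing \<open>y\<close> has index \<open>a\<close>, so weights are
    needed on \<open>{..a}\<close> and not just on \<open>{..<a}\<close>.\<close>
  obtain w :: "omega1 \<Rightarrow> real" where w: "\<And>b. b \<in> {..a} \<Longrightarrow> 0 < w b" "w summable_on {..a}"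
    using countable_summable_weights[OF countable_atMost_omega1[of a]] by metis
  define S where "S b = infsum w {..<b}" for b
  have summ: "w summable_on {..<b}" "w summable_on {..b}" if "b \<le> a" for b
    by (rule summable_on_subset_banach[OF w(2)]; use that in auto)+
  have S_step: "S b + w b \<le> S c" if "b < c" "c \<le> a" for b c
  proof -
    have "{..b} = insert b {..<b}" by auto
    then have "S b + w b = infsum w {..b}"
      using infsum_insert[of w "{..<b}" b] summ[of b] that by (simp add: S_def)
    also have "\<dots> \<le> S c" unfolding S_def
      by (rule infsum_mono2) (use that summ w(1) in \<open>auto intro: less_imp_le\<close>)
    finally show ?thesis .
  qed
  \<comment> \<open>A finite partial sum stays below the cell end \<open>S c + w c\<close> of its
    largest index \<open>c\<close>. So \<open>S\<close> jumps over nothing at limit ordinals, which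
    is what makes the image of \<open>\<phi>\<close> a full interval.\<close>
  have S_sup: "S b \<le> r" if "b \<le> a" "0 \<le> r" "\<And>c. c < b \<Longrightarrow> S c + w c \<le> r" for b r
    unfolding S_def
  proof (rule infsum_le_finite_sums[OF summ(1)[OF that(1)]])
    fix F assume F: "finite F" "F \<subseteq> {..<b}"
    show "sum w F \<le> r"
    proof (cases "F = {}")
      case False
      let ?m = "Max F"
      have m: "?m \<in> F" using F False by simp
      then have mb: "?m < b" using F by auto
      have "sum w F = infsum w F" using F by simp
      also have "\<dots> \<le> infsum w {..?m}"
        by (rule infsum_mono2) (use F that(1) mb summ(2)[of ?m] w(1) in \<open>auto intro: less_imp_le\<close>)
      also have "\<dots> = S ?m + w ?m"
      proof -
        have "{..?m} = insert ?m {..<?m}" by auto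
        then show ?thesis using infsum_insert[of w "{..<?m}" ?m] summ[of ?m] that mb by (simp add: S_def)
      qed
      also have "\<dots> \<le> r" by (rule that(3)[OF mb])
      finally show ?thesis .
    qed (use that in simp)
  qed
  have S_nonneg: "0 \<le> S b" if "b \<le> a" for b
    unfolding S_def by (rule infsum_nonneg) (use that w(1) in \<open>auto intro: less_imp_le\<close>)
  define \<phi> where "\<phi> z = (case Rep_long_ray z of (b, t) \<Rightarrow> S b + t * w b)" for z
  have \<phi>: "\<phi> (Abs_long_ray (b, t)) = S b + t * w b" if "0 \<le> t" "t < 1" for b t
    using that by (simp add: \<phi>_def Abs_long_ray_inverse)
  have mono: "\<phi> (Abs_long_ray (b, t)) < \<phi> (Abs_long_ray (c, s))"
    if m: "Abs_long_ray (b, t) < Abs_long_ray (c, s)" "c \<le> a" "0 \<le> t" "t < 1" "0 \<le> s" "s < 1" for b c t s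
  proof -
    consider "b < c" | "b = c" "t < s" using m Abs_long_ray_le(2)[of t s b c] by auto
    then show ?thesis
    proof cases
      case 1
      have "t * w b < 1 * w b" by (rule mult_strict_right_mono) (use m w(1) 1 in auto)
      moreover have "0 \<le> s * w c" using m w(1)[of c] by simp
      ultimately show ?thesis using \<phi> m S_step[OF 1] by simp
    next
      case 2
      have "t * w b < s * w b" by (rule mult_strict_right_mono) (use m w(1) 2 in auto)
      then show ?thesis using \<phi> m 2 by simp
    qed
  qed
  have mono': "\<phi> z < \<phi> z'" if "z < z'" "z' \<le> y" for z z'
  proof -
    obtain b t where z: "z = Abs_long_ray (b, t)" "0 \<le> t" "t < 1" by (rule Rep_long_ray_cases)
    obtain c s where z': "z' = Abs_long_ray (c, s)" "0 \<le> s" "s < 1" by (rule Rep_long_ray_cases)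
    have "c \<le> a" using that(2) z' y Abs_long_ray_le(1)[of s u c a] by auto
    then show ?thesis using mono[of b t c s] z z' that by simp
  qed
  have lt: "\<phi> x < \<phi> y" using mono'[of x y] xy by (simp add: order_less_le)
  have "order_iso {x..y} (\<le>) {\<phi> x..\<phi> y} (\<le>) \<phi>"
  proof (rule order_isoI[OF linear_on_linorder linear_on_linorder])
    show "\<phi> z \<le> \<phi> z' \<and> \<phi> z \<noteq> \<phi> z'" if "z \<in> {x..y}" "z' \<in> {x..y}" "z \<le> z'" "z \<noteq> z'" for z z'
      using mono'[of z z'] that by (simp add: order_less_le)
    show "\<phi> ` {x..y} = {\<phi> x..\<phi> y}"
    proof (intro equalityI subsetI)
      fix r assume "r \<in> \<phi> ` {x..y}"
      then obtain z where "x \<le> z" "z \<le> y" "r = \<phi> z" by auto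
      then show "r \<in> {\<phi> x..\<phi> y}" using mono'[of x z] mono'[of z y] by (auto simp: order_le_less)
    next
      fix r assume r: "r \<in> {\<phi> x..\<phi> y}"
      obtain b0 t0 where x: "x = Abs_long_ray (b0, t0)" "0 \<le> t0" "t0 < 1" by (rule Rep_long_ray_cases)
      have b0: "b0 \<le> a" using xy x y Abs_long_ray_le(1)[of t0 u b0 a] by auto
      have "0 \<le> \<phi> x" using \<phi>[of t0 b0] x S_nonneg[OF b0] w(1)[of b0] b0 by simp
      then have r0: "0 \<le> r" using r by simp
      \<comment> \<open>The cell containing \<open>r\<close> is the first one whose upper end
        exceeds \<open>r\<close>; the cell of \<open>y\<close> witnesses that there is one.\<close>
      define P where "P b \<longleftrightarrow> b \<le> a \<and> r < S b + w b" for b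
      have "u * w a < 1 * w a" by (rule mult_strict_right_mono) (use y w(1) in auto)
      then have Pa: "P a" using r \<phi>[of u a] y by (simp add: P_def)
      define b where "b = (LEAST b. P b)"
      have Pb: "P b" unfolding b_def by (rule LeastI[of P, OF Pa])
      then have b: "b \<le> a" "r < S b + w b" by (auto simp: P_def)
      have "S b \<le> r"
      proof (rule S_sup[OF b(1) r0])
        fix c assume c: "c < b"
        then have "\<not> P c" unfolding b_def by (rule not_less_Least)
        then show "S c + w c \<le> r" using c b by (auto simp: P_def)
      qed
      define t where "t = (r - S b) / w b"
      have wb: "0 < w b" using w(1) b by simp
      have t: "0 \<le> t" "t < 1" using b \<open>S b \<le> r\<close> wb by (auto simp: t_def)
      define z where "z = Abs_long_ray (b, t)"
      have z: "\<phi> z = r" using \<phi>[OF t, of b] wb by (simp add: z_def t_def)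
      have "z \<le> y"
      proof (rule ccontr)
        assume "\<not> z \<le> y"
        then have "\<phi> y < \<phi> z" using mono[of a u b t] t b y by (simp add: z_def)
        then show False using z r by simp
      qed
      moreover have "x \<le> z"
        using mono'[of z x] xy z r by (metis atLeastAtMost_iff not_le_imp_less not_less)
      ultimately show "r \<in> \<phi> ` {x..y}" using z by auto
    qed
  qed
  from order_iso_unit_interval[OF lt order_iso_inv[OF this]]
  show "\<exists>k. order_iso {0..1::real} (\<le>) {x..y} (\<le>) k" by metis
qed

lemma long_rightD:
  assumes "long_right A le" "C \<subseteq> A" "countable C"
  shows "\<exists>u\<in>A. \<forall>c\<in>C. le c u \<and> c \<noteq> u"
  using assms(1)[unfolded long_right_def, rule_format, of C] assms(2,3) by simp

text \<open>Only the ordinal coordinates matter: countably many countable initial segments do not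
  exhaust \<open>omega1\<close>.\<close>

lemma long_right_long_ray: "long_right (UNIV :: long_ray set) (\<le>)"
  unfolding long_right_def
proof (intro allI impI)
  fix C :: "long_ray set" assume "C \<subseteq> UNIV \<and> countable C"
  then have "countable (\<Union>x\<in>C. {..fst (Rep_long_ray x)})" by (auto intro: countable_atMost_omega1)
  then obtain a where a: "a \<notin> (\<Union>x\<in>C. {..fst (Rep_long_ray x)})"
    using uncountable_omega1 by (metis UNIV_I subsetI subset_antisym)
  have "x < Abs_long_ray (a, 0)" if "x \<in> C" for x
  proof -
    obtain b t where x: "x = Abs_long_ray (b, t)" "0 \<le> t" "t < 1" by (rule Rep_long_ray_cases)
    then have "b < a" using a that by (auto simp: Abs_long_ray_inverse)
    then show ?thesis using Abs_long_ray_le(2)[of t 0 b a] x by simp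
  qed
  then show "\<exists>u\<in>UNIV. \<forall>c\<in>C. c \<le> u \<and> c \<noteq> u" by (metis UNIV_I less_imp_le less_irrefl)
qed

section \<open>The long line as two long rays meeting at zero\<close>

definition neg_line_of_ray :: "long_ray \<Rightarrow> long_line" where
  "neg_line_of_ray x = - line_of_ray x"

lemma Rep_line_of_ray: "Rep_long_line (line_of_ray x) = Inr x"
  by (simp add: line_of_ray_def Abs_long_line_inverse)

lemma Rep_neg_line_of_ray: "Rep_long_line (neg_line_of_ray x) = (if x = 0 then Inr 0 else Inl x)"
  by (simp add: neg_line_of_ray_def uminus_long_line_def Rep_line_of_ray zero_long_line_def
      Abs_long_line_inverse)

lemma order_iso_line_of_ray: "order_iso UNIV (\<le>) {0..} (\<le>) line_of_ray"
proof (rule order_isoI[OF linear_on_linorder linear_on_linorder])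
  show "line_of_ray x \<le> line_of_ray y \<and> line_of_ray x \<noteq> line_of_ray y" if "x \<le> y" "x \<noteq> y" for x y
    using that Rep_line_of_ray[of x] Rep_line_of_ray[of y] by (auto simp: less_eq_long_line_def)
  show "range line_of_ray = {0..}"
  proof (intro equalityI subsetI)
    fix p :: long_line assume "p \<in> {0..}"
    then obtain x where "Rep_long_line p = Inr x"
      by (cases "Rep_long_line p") (auto simp: less_eq_long_line_def zero_long_line_def Rep_line_of_ray)
    then have "p = line_of_ray x" by (metis Rep_long_line_inject Rep_line_of_ray)
    then show "p \<in> range line_of_ray" by simp
  qed (auto simp: less_eq_long_line_def zero_long_line_def Rep_line_of_ray)
qed

text \<open>The lower half is the ray upside down, hence the target relation \<open>(\<ge>)\<close>;
  facts about the ray then reach it by duality.\<close>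

lemma order_iso_neg_line_of_ray: "order_iso UNIV (\<le>) {..0} (\<ge>) neg_line_of_ray"
proof (rule order_isoI[OF linear_on_linorder])
  show "linear_on {..0 :: long_line} (\<ge>)" by (rule linear_on_dual) simp
  show "neg_line_of_ray y \<le> neg_line_of_ray x \<and> neg_line_of_ray x \<noteq> neg_line_of_ray y"
    if "x \<le> y" "x \<noteq> y" for x y
  proof -
    have "y \<noteq> 0" using that long_ray_zero_le[of x] by (metis antisym)
    then show ?thesis
      using that Rep_neg_line_of_ray[of x] Rep_neg_line_of_ray[of y]
      by (auto simp: less_eq_long_line_def split: if_splits)
  qed
  show "range neg_line_of_ray = {..0}"
  proof (intro equalityI subsetI)
    fix p :: long_line assume p: "p \<in> {..0}"
    show "p \<in> range neg_line_of_ray"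
    proof (cases "Rep_long_line p")
      case (Inl x)
      then have "x \<noteq> 0" using Rep_long_line[of p] by auto
      then have "p = neg_line_of_ray x" using Inl by (metis Rep_long_line_inject Rep_neg_line_of_ray)
      then show ?thesis by simp
    next
      case (Inr x)
      then have "x \<le> 0" using p by (auto simp: less_eq_long_line_def zero_long_line_def Rep_line_of_ray)
      then have "x = 0" using long_ray_zero_le[of x] by simp
      then have "p = neg_line_of_ray 0" using Inr by (metis Rep_long_line_inject Rep_neg_line_of_ray)
      then show ?thesis by simp
    qed
  qed (auto simp: less_eq_long_line_def zero_long_line_def Rep_line_of_ray Rep_neg_line_of_ray)
qed

lemma locally_real_long_line: "locally_real (UNIV :: long_line set) (\<le>)"
proof (rule locally_real_glue[of _ _ 0])
  show "locally_real {x \<in> (UNIV :: long_line set). 0 \<le> x} (\<le>)"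
    using locally_real_iso[OF order_iso_line_of_ray locally_real_long_ray] by (simp add: atLeast_def)
  have "locally_real {..0 :: long_line} (\<ge>)"
    by (rule locally_real_iso[OF order_iso_neg_line_of_ray locally_real_long_ray])
  from locally_real_dual[OF this]
  show "locally_real {x \<in> (UNIV :: long_line set). x \<le> 0} (\<le>)" by (simp add: atMost_def)
qed simp_all

lemma countable_vimage_inj: "inj f \<Longrightarrow> countable C \<Longrightarrow> countable (f -` C)"
  by (rule countable_image_inj_on[of f]) (auto intro: countable_subset[of _ C] inj_on_subset)

lemma long_right_long_line: "long_right (UNIV :: long_line set) (\<le>)"
  unfolding long_right_def
proof (intro allI impI)
  fix C :: "long_line set" assume C: "C \<subseteq> UNIV \<and> countable C"
  have "countable (insert 0 (line_of_ray -` C))"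
    using C countable_vimage_inj[OF order_iso_inj[OF order_iso_line_of_ray]] by simp
  from long_rightD[OF long_right_long_ray subset_UNIV this]
  obtain u where u: "\<And>c. c \<in> insert 0 (line_of_ray -` C) \<Longrightarrow> c \<le> u \<and> c \<noteq> u"
    by blast
  have "c < line_of_ray u" if "c \<in> C" for c
  proof (cases "0 \<le> c")
    case True
    then obtain x where "c = line_of_ray x" using order_iso_image[OF order_iso_line_of_ray] by (metis atLeast_iff imageE)
    then show ?thesis
      using u[of x] that order_iso_le[OF order_iso_line_of_ray, of x u] order_iso_eq[OF order_iso_line_of_ray, of x u]
      by auto
  next
    case False
    moreover have "0 \<le> line_of_ray u" using order_iso_mem[OF order_iso_line_of_ray, of u] by simp
    ultimately show ?thesis by simp
  qed
  then show "\<exists>u\<in>UNIV. \<forall>c\<in>C. c \<le> u \<and> c \<noteq> u" by (metis UNIV_I less_imp_le less_irrefl)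
qed

lemma long_left_long_line: "long_right (UNIV :: long_line set) (\<ge>)"
  unfolding long_right_def
proof (intro allI impI)
  fix C :: "long_line set" assume C: "C \<subseteq> UNIV \<and> countable C"
  have "countable (insert 0 (neg_line_of_ray -` C))"
    using C countable_vimage_inj[OF order_iso_inj[OF order_iso_neg_line_of_ray]] by simp
  from long_rightD[OF long_right_long_ray subset_UNIV this]
  obtain u where u: "\<And>c. c \<in> insert 0 (neg_line_of_ray -` C) \<Longrightarrow> c \<le> u \<and> c \<noteq> u"
    by blast
  have "neg_line_of_ray u < c" if "c \<in> C" for c
  proof (cases "c \<le> 0")
    case True
    then obtain x where "c = neg_line_of_ray x"
      using order_iso_image[OF order_iso_neg_line_of_ray] by (metis atMost_iff imageE)
    then show ?thesis
      using u[of x] that order_iso_le[OF order_iso_neg_line_of_ray, of x u]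
        order_iso_eq[OF order_iso_neg_line_of_ray, of x u]
      by auto
  next
    case False
    moreover have "neg_line_of_ray u \<le> 0" using order_iso_mem[OF order_iso_neg_line_of_ray, of u] by simp
    ultimately show ?thesis by simp
  qed
  then show "\<exists>u\<in>UNIV. \<forall>c\<in>C. u \<le> c \<and> c \<noteq> u" by (metis UNIV_I less_imp_le less_irrefl)
qed

section \<open>Uniqueness of orders with one or two long ends\<close>

lemma long_ray_order_iso_upper:
  assumes A: "linear_on A le" "locally_real A le" "long_right A le" and v: "v \<in> A"
  obtains h where "order_iso (UNIV :: long_ray set) (\<le>) {x\<in>A. le v x} le h"
proof (rule long_ray_order_iso[of "{x\<in>A. le v x}" le v])
  note A' = linear_onD[OF A(1)]
  show "linear_on {x\<in>A. le v x} le" by (rule linear_on_subset[OF A(1)]) auto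
  show "locally_real {x\<in>A. le v x} le"
  proof (rule locally_real_subset[OF A(2)])
    show "z \<in> {x\<in>A. le v x}" if "x \<in> {x\<in>A. le v x}" "z \<in> A" "le x z" for x z
      using A'(2)[of v x z] v that by simp
  qed auto
  show "long_right {x\<in>A. le v x} le"
    unfolding long_right_def
  proof (intro allI impI)
    fix C assume "C \<subseteq> {x\<in>A. le v x} \<and> countable C"
    \<comment> \<open>Including \<open>v\<close> keeps the bound inside the upper part even when
      \<open>C\<close> is empty.\<close>
    then have "insert v C \<subseteq> A" "countable (insert v C)" using v by auto
    from long_rightD[OF A(3) this] obtain u where "u \<in> A" "\<forall>c\<in>insert v C. le c u \<and> c \<noteq> u" ..
    then show "\<exists>u\<in>{x\<in>A. le v x}. \<forall>c\<in>C. le c u \<and> c \<noteq> u" by auto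
  qed
qed (use v linear_onD(1)[OF A(1)] in auto)

text \<open>Both upper parts are copies of the long ray, so the ray serves as the
  intermediary.\<close>

lemma long_upper_order_iso:
  assumes "linear_on A le" "locally_real A le" "long_right A le" "v \<in> A"
    and "linear_on B le'" "locally_real B le'" "long_right B le'" "v' \<in> B"
  obtains h where "order_iso {x\<in>A. le v x} le {y\<in>B. le' v' y} le' h"
proof -
  obtain f where f: "order_iso (UNIV :: long_ray set) (\<le>) {x\<in>A. le v x} le f"
    by (rule long_ray_order_iso_upper[OF assms(1-4)])
  obtain g where g: "order_iso (UNIV :: long_ray set) (\<le>) {y\<in>B. le' v' y} le' g"
    by (rule long_ray_order_iso_upper[OF assms(5-8)])
  show ?thesis by (rule that[OF order_iso_comp[OF order_iso_inv[OF f] g]])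
qed

text \<open>Both tails are matched through the long ray and the middle segments through the unit
  interval. The freedom to prescribe two points is what later puts limit points at the constants of
  the list.\<close>

theorem two_sided_long_order_iso:
  assumes A: "linear_on A le" "locally_real A le" "long_right A le" "long_right A (\<lambda>x y. le y x)"
    and B: "linear_on B le'" "locally_real B le'" "long_right B le'" "long_right B (\<lambda>x y. le' y x)"
    and u: "u \<in> A" "v \<in> A" "le u v" and u': "u' \<in> B" "v' \<in> B" "le' u' v'"
    and eq: "u = v \<longleftrightarrow> u' = v'"
  obtains h where "order_iso A le B le' h" "h u = u'" "h v = v'"
proof -
  note A' = linear_onD[OF A(1)] and B' = linear_onD[OF B(1)]
  obtain f where f: "order_iso {x\<in>A. le v x} le {y\<in>B. le' v' y} le' f"
    by (rule long_upper_order_iso[OF A(1-3) u(2) B(1-3) u'(2)])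
  \<comment> \<open>A lower tail is an upper tail of the reversed order.\<close>
  obtain g where "order_iso {x\<in>A. le x u} (\<lambda>x y. le y x) {y\<in>B. le' y u'} (\<lambda>x y. le' y x) g"
    by (rule long_upper_order_iso[OF linear_on_dual[OF A(1)] locally_real_dual[OF A(2)] A(4) u(1)
      linear_on_dual[OF B(1)] locally_real_dual[OF B(2)] B(4) u'(1)])
  then have g: "order_iso {x\<in>A. le x u} le {y\<in>B. le' y u'} le' g" by (rule order_iso_dual)
  show ?thesis
  proof (cases "u = v")
    case True
    then have "u' = v'" using eq by simp
    obtain h where "order_iso A le B le' h" "h u = u'"
      using order_iso_glue[OF A(1) B(1) u(1) u'(1) g] f True \<open>u' = v'\<close> by metis
    then show ?thesis using that True \<open>u' = v'\<close> by simp
  next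
    case False
    then have "u' \<noteq> v'" using eq by simp
    obtain k where k: "order_iso {0..1::real} (\<le>) (seg A le u v) le k"
      by (rule locally_realD[OF A(2) u False])
    obtain k' where k': "order_iso {0..1::real} (\<le>) (seg B le' u' v') le' k'"
      by (rule locally_realD[OF B(2) u' \<open>u' \<noteq> v'\<close>])
    have mid: "order_iso (seg A le u v) le (seg B le' u' v') le' (k' \<circ> inv_into {0..1} k)"
      by (rule order_iso_comp[OF order_iso_inv[OF k] k'])
    let ?A = "{x\<in>A. le x v}" and ?B = "{y\<in>B. le' y v'}"
    have eA: "{x\<in>?A. le x u} = {x\<in>A. le x u}" "{x\<in>?A. le u x} = seg A le u v"
      using A'(2)[OF _ u(1,2) _ u(3)] unfolding seg_def by blast+
    have eB: "{x\<in>?B. le' x u'} = {x\<in>B. le' x u'}" "{x\<in>?B. le' u' x} = seg B le' u' v'"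
      using B'(2)[OF _ u'(1,2) _ u'(3)] unfolding seg_def by blast+
    obtain h1 where h1: "order_iso ?A le ?B le' h1" "h1 u = u'"
    proof (rule order_iso_glue[of ?A le ?B le' u u' g "k' \<circ> inv_into {0..1} k", unfolded eA eB])
      show "linear_on ?A le" "linear_on ?B le'" by (auto intro: linear_on_subset[OF A(1)] linear_on_subset[OF B(1)])
    qed (use u u' g mid in auto)
    obtain h where h: "order_iso A le B le' h" "\<And>x. x \<in> A \<Longrightarrow> le x v \<Longrightarrow> h x = h1 x" "h v = v'"
      using order_iso_glue[OF A(1) B(1) u(2) u'(2) h1(1) f] by metis
    show ?thesis using that[OF h(1)] h(2)[OF u(1,3)] h1(2) h(3) by simp
  qed
qed

section \<open>Continuity of order isomorphisms\<close>

text \<open>By convexity a threshold outside \<open>T\<close> has all of \<open>T\<close> on one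
  side, so its preimages are trivial; a threshold in \<open>T\<close> pulls back to a ray of
  \<open>S\<close>.\<close>

lemma order_iso_continuous_on:
  fixes f :: "'a::linorder_topology \<Rightarrow> 'b::linorder_topology"
  assumes f: "order_iso S (\<le>) T (\<le>) f"
    and convex: "\<And>x y. x \<in> T \<Longrightarrow> y \<in> T \<Longrightarrow> {x..y} \<subseteq> T"
  shows "continuous_on S f"
proof (rule continuous_on_generate_topology[OF open_generated_order], safe)
  note im = order_iso_image[OF f] and mem = order_iso_mem[OF f] and le = order_iso_le[OF f]
  fix a
  consider c where "c \<in> S" "f c = a" | "a \<notin> T" using im by (metis imageE)
  then have "(\<exists>C. open C \<and> C \<inter> S = f -` {..<a} \<inter> S) \<and> (\<exists>C. open C \<and> C \<inter> S = f -` {a<..} \<inter> S)"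
  proof cases
    case 1
    then have "{..<c} \<inter> S = f -` {..<a} \<inter> S" "{c<..} \<inter> S = f -` {a<..} \<inter> S"
      using le by (auto simp: not_le[symmetric])
    then show ?thesis by (metis open_lessThan open_greaterThan)
  next
    case 2
    then have "(\<forall>t\<in>T. t < a) \<or> (\<forall>t\<in>T. a < t)"
      using convex by (meson atLeastAtMost_iff in_mono not_le_imp_less order_le_less)
    then show ?thesis
    proof
      assume "\<forall>t\<in>T. t < a"
      then have "f x < a" "\<not> a < f x" if "x \<in> S" for x using mem[OF that] by (auto dest: less_asym)
      then have "UNIV \<inter> S = f -` {..<a} \<inter> S" "{} \<inter> S = f -` {a<..} \<inter> S" by auto
      then show ?thesis using open_UNIV open_empty by blast
    next
      assume "\<forall>t\<in>T. a < t"
      then have "a < f x" "\<not> f x < a" if "x \<in> S" for x using mem[OF that] by (auto dest: less_asym)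
      then have "{} \<inter> S = f -` {..<a} \<inter> S" "UNIV \<inter> S = f -` {a<..} \<inter> S" by auto
      then show ?thesis using open_UNIV open_empty by blast
    qed
  qed
  then show "\<exists>C. open C \<and> C \<inter> S = f -` {..<a} \<inter> S" "\<exists>C. open C \<and> C \<inter> S = f -` {a<..} \<inter> S"
    by blast+
qed

lemma locally_real_interval:
  fixes u v :: "'a::linorder_topology"
  assumes "locally_real (UNIV :: 'a set) (\<le>)" "u < v"
  obtains k where "order_iso {0..1::real} (\<le>) {u..v} (\<le>) k" "continuous_on {0..1} k"
proof -
  obtain k where k: "order_iso {0..1::real} (\<le>) {u..v} (\<le>) k"
    using locally_realD[OF assms(1), of u v] assms(2) by (auto simp: less_imp_le)
  moreover have "continuous_on {0..1} k" by (rule order_iso_continuous_on[OF k]) auto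
  ultimately show ?thesis by (rule that)
qed

lemma locally_real_compact_interval:
  fixes u v :: "'a::linorder_topology"
  assumes "locally_real (UNIV :: 'a set) (\<le>)"
  shows "compact {u..v}"
proof (cases "u < v")
  case True
  then obtain k where "order_iso {0..1::real} (\<le>) {u..v} (\<le>) k" "continuous_on {0..1} k"
    by (rule locally_real_interval[OF assms])
  then show ?thesis using compact_continuous_image[of "{0..1}" k] order_iso_image by fastforce
next
  case False
  then show ?thesis by (cases "u = v") auto
qed

section \<open>Arcs in Hausdorff spaces and pasting of maps along intervals\<close>

lemma is_arc_inj_image:
  assumes "is_arc X" "continuous_map X K f" "inj_on f (topspace X)" "Hausdorff_space K"
  shows "is_arc (subtopology K (f ` topspace X))"
proof -
  have "compact_space X"
    using assms(1) unfolding is_arc_def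
    by (metis compact_Icc compact_space_subtopology compactin_euclidean_iff homeomorphic_compact_space)
  then have "closed_map X K f" by (rule continuous_imp_closed_map[OF assms(2) _ assms(4)])
  then have "embedding_map X K f" using assms(2,3) by (intro injective_closed_imp_embedding_map)
  then have "X homeomorphic_space subtopology K (f ` topspace X)"
    by (rule embedding_map_imp_homeomorphic_space)
  then show ?thesis
    using assms(1) unfolding is_arc_def using homeomorphic_space_sym homeomorphic_space_trans by metis
qed

lemma Hausdorff_space_euclidean_t2: "Hausdorff_space (euclidean :: 'a::t2_space topology)"
  by (auto simp: Hausdorff_space_def disjnt_def separation_t2)

lemma locally_real_is_arc_interval:
  fixes u v :: "'a::linorder_topology"
  assumes "locally_real (UNIV :: 'a set) (\<le>)" "u < v"
  shows "is_arc (top_of_set {u..v})"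
proof -
  obtain k where k: "order_iso {0..1::real} (\<le>) {u..v} (\<le>) k" "continuous_on {0..1} k"
    by (rule locally_real_interval[OF assms])
  have "is_arc (top_of_set {0..1::real})" unfolding is_arc_def by (rule homeomorphic_space_refl)
  from is_arc_inj_image[OF this, of euclidean k] show ?thesis
    using k(2) order_iso_inj[OF k(1)] order_iso_image[OF k(1)] Hausdorff_space_euclidean_t2 by simp
qed

text \<open>Every point has an open neighbourhood inside a closed interval. The disjunction
  \<open>bot\<close> covers both the line, which has no least point, and the ray, where the least
  point has half-open neighbourhoods.\<close>

lemma continuous_map_locally_on_intervals:
  fixes h :: "'b::linorder_topology \<Rightarrow> 'a"
  assumes cont: "\<And>u v. u < v \<Longrightarrow> continuous_map (top_of_set {u..v}) K h"
    and top: "\<And>x::'b. \<exists>y. x < y"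
    and bot: "(\<forall>x::'b. \<exists>y. y < x) \<or> (\<exists>m::'b. \<forall>x. m \<le> x)"
  shows "continuous_map euclidean K h"
\<comment> \<open>An index carries the open set used for pasting together with the ends of a closed
  interval around it on which continuity is known.\<close>
proof (rule pasting_lemma[of "{(U, u, v). open U \<and> u < v \<and> U \<subseteq> {u..v}}" _ fst _ "\<lambda>_. h"])
  fix i :: "'b set \<times> 'b \<times> 'b" assume "i \<in> {(U, u, v). open U \<and> u < v \<and> U \<subseteq> {u..v}}"
  then obtain U u v where i: "i = (U, u, v)" "open U" "u < v" "U \<subseteq> {u..v}" by auto
  then show "openin euclidean (fst i)" by simp
  show "continuous_map (subtopology euclidean (fst i)) K h"
    using continuous_map_from_subtopology_mono[OF cont[OF i(3)]] i by simp
next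
  fix x :: 'b
  obtain v where v: "x < v" using top by blast
  have "\<exists>U u. open U \<and> u < v \<and> U \<subseteq> {u..v} \<and> x \<in> U"
    using bot
  proof
    assume "\<forall>x::'b. \<exists>y. y < x"
    then obtain u where "u < x" by blast
    then show ?thesis using v by (intro exI[of _ "{u<..<v}"] exI[of _ u]) auto
  next
    assume "\<exists>m::'b. \<forall>x. m \<le> x"
    then obtain m :: 'b where m: "\<And>x. m \<le> x" by blast
    then have "m < v" using v by (meson le_less_trans)
    then show ?thesis using v m by (intro exI[of _ "{..<v}"] exI[of _ m]) auto
  qed
  then show "\<exists>j. j \<in> {(U, u, v). open U \<and> u < v \<and> U \<subseteq> {u..v}} \<and> x \<in> fst j \<and> h x = h x"
    by auto
qed simp

section \<open>Orders whose segments are arcs of the space\<close>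

text \<open>Only the parametrisations of segments tie the order to the topology. Asking for the
  order topology would be too much: in the long circle, for instance, every neighbourhood of the
  identified point contains a tail of the ray.\<close>

definition arc_order :: "'a topology \<Rightarrow> ('a \<Rightarrow> 'a \<Rightarrow> bool) \<Rightarrow> bool" where
  "arc_order K le \<longleftrightarrow> linear_on (topspace K) le \<and>
     (\<forall>x\<in>topspace K. \<forall>y\<in>topspace K. le x y \<and> x \<noteq> y \<longrightarrow>
        (\<exists>k. order_iso {0..1::real} (\<le>) (seg (topspace K) le x y) le k \<and>
             continuous_map (top_of_set {0..1}) K k))"

lemma arc_orderD:
  assumes "arc_order K le" "x \<in> topspace K" "y \<in> topspace K" "le x y" "x \<noteq> y"
  shows "\<exists>k. order_iso {0..1::real} (\<le>) (seg (topspace K) le x y) le k \<and>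
             continuous_map (top_of_set {0..1}) K k"
  using assms(1)[unfolded arc_order_def, THEN conjunct2, rule_format, of x y] assms(2-) by simp

lemma arc_order_linear: "arc_order K le \<Longrightarrow> linear_on (topspace K) le"
  by (simp add: arc_order_def)

lemma arc_order_locally_real: "arc_order K le \<Longrightarrow> locally_real (topspace K) le"
  unfolding arc_order_def locally_real_def by metis

lemma arc_order_dual:
  assumes "arc_order K le"
  shows "arc_order K (\<lambda>x y. le y x)"
  unfolding arc_order_def seg_dual[of "topspace K" le]
proof (intro conjI ballI impI)
  show "linear_on (topspace K) (\<lambda>x y. le y x)" by (rule linear_on_dual[OF arc_order_linear[OF assms]])
  fix x y assume xy: "x \<in> topspace K" "y \<in> topspace K" "le y x \<and> x \<noteq> y"
  obtain k where k: "order_iso {0..1::real} (\<le>) (seg (topspace K) le y x) le k"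
    "continuous_map (top_of_set {0..1}) K k"
    using arc_orderD[OF assms xy(2,1)] xy(3) by metis
  have "continuous_map (top_of_set {0..1::real}) (top_of_set {0..1}) (\<lambda>t. 1 - t)"
    by (auto simp: continuous_map_in_subtopology intro!: continuous_intros)
  then have "continuous_map (top_of_set {0..1}) K (k \<circ> (\<lambda>t. 1 - t))"
    using k(2) by (rule continuous_map_compose)
  then show "\<exists>k. order_iso {0..1::real} (\<le>) (seg (topspace K) le y x) (\<lambda>x y. le y x) k \<and>
             continuous_map (top_of_set {0..1}) K k"
    using order_iso_comp[OF order_iso_flip order_iso_dual[OF k(1)]] by blast
qed

text \<open>On an interval, \<open>h\<close> is the continuous parametrisation \<open>k\<close> of a
  segment after an order isomorphism of that interval with \<open>{0..1}\<close>, and the latter is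
  automatically continuous.\<close>

lemma arc_order_iso_continuous_map:
  fixes h :: "'b::linorder_topology \<Rightarrow> 'a"
  assumes K: "arc_order K le" and h: "order_iso UNIV (\<le>) (topspace K) le h"
    and top: "\<And>x::'b. \<exists>y. x < y"
    and bot: "(\<forall>x::'b. \<exists>y. y < x) \<or> (\<exists>m::'b. \<forall>x. m \<le> x)"
  shows "continuous_map euclidean K h"
proof (rule continuous_map_locally_on_intervals[OF _ top bot])
  fix u v :: 'b assume uv: "u < v"
  have hu: "h u \<in> topspace K" "h v \<in> topspace K" using order_iso_mem[OF h] by auto
  have "le (h u) (h v)" "h u \<noteq> h v" using order_iso_le[OF h, of u v] order_iso_eq[OF h, of u v] uv by auto
  then obtain k where k: "order_iso {0..1::real} (\<le>) (seg (topspace K) le (h u) (h v)) le k"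
    "continuous_map (top_of_set {0..1}) K k"
    using arc_orderD[OF K hu] by metis
  have g: "order_iso {u..v} (\<le>) {0..1::real} (\<le>) (inv_into {0..1} k \<circ> h)"
    using order_iso_comp[OF order_iso_seg[OF h, of u v] order_iso_inv[OF k(1)]] by simp
  have "continuous_on {u..v} (inv_into {0..1} k \<circ> h)" by (rule order_iso_continuous_on[OF g]) auto
  then have "continuous_map (top_of_set {u..v}) (top_of_set {0..1}) (inv_into {0..1} k \<circ> h)"
    using order_iso_image[OF g] by (auto simp: continuous_map_in_subtopology)
  from continuous_map_compose[OF this k(2)]
  show "continuous_map (top_of_set {u..v}) K h"
  proof (rule continuous_map_eq)
    fix x assume "x \<in> topspace (top_of_set {u..v})"
    then have "h x \<in> seg (topspace K) le (h u) (h v)"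
      using order_iso_mem[OF order_iso_seg[OF h, of u v], of x] by simp
    then show "(k \<circ> (inv_into {0..1} k \<circ> h)) x = h x"
      using order_iso_image[OF k(1)] by (simp add: f_inv_into_f)
  qed
qed

section \<open>Maps from the long ray into compact spaces\<close>

lemma long_ray_gt_ex: "\<exists>y. x < (y :: long_ray)"
  using long_rightD[OF long_right_long_ray, of "{x}"] by (auto simp: order_less_le)

lemma long_line_gt_ex: "\<exists>y. x < (y :: long_line)"
  using long_rightD[OF long_right_long_line, of "{x}"] by (auto simp: order_less_le)

lemma long_line_lt_ex: "\<exists>y. y < (x :: long_line)"
  using long_rightD[OF long_left_long_line, of "{x}"] by (auto simp: order_less_le)

text \<open>A sequence alternating between \<open>F\<close> and \<open>G\<close> has a supremum
  because the ray has uncountable cofinality; the supremum is approached from both sets, hence lies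
  in both.\<close>

lemma long_ray_closed_unbounded_meet:
  fixes F G :: "long_ray set"
  assumes "closed F" "closed G" "\<And>b. \<exists>x\<in>F. b < x" "\<And>b. \<exists>x\<in>G. b < x"
  shows "F \<inter> G \<noteq> {}"
proof -
  obtain f g where f: "\<And>b. f b \<in> F \<and> b < f b" and g: "\<And>b. g b \<in> G \<and> b < g b"
    using assms(3,4) by metis
  \<comment> \<open>Each \<open>a n\<close> lies in \<open>F\<close>, and \<open>g (a n)\<close> is
    a point of \<open>G\<close> strictly between \<open>a n\<close> and
    \<open>a (Suc n)\<close>.\<close>
  define a where "a n = ((\<lambda>x. f (g x)) ^^ n) (f 0)" for n
  have aS: "a (Suc n) = f (g (a n))" for n by (simp add: a_def)
  have aF: "a n \<in> F" for n by (cases n) (auto simp: a_def f)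
  have ag: "a n < g (a n)" "g (a n) < a (Suc n)" for n using f g aS by auto
  obtain z where "is_lub UNIV (\<le>) (range a) z"
    by (rule countable_lub_exists[OF linear_on_linorder locally_real_long_ray long_right_long_ray, of "range a"]) auto
  then have z: "\<And>n. a n \<le> z" "\<And>w. (\<And>n. a n \<le> w) \<Longrightarrow> z \<le> w" by (auto simp: is_lub_def)
  have near: "\<exists>n. c < a n" if "c < z" for c using z(2)[of c] that by (meson leD not_le_imp_less)
  \<comment> \<open>Strictness supplies the point to the left of \<open>z\<close> that
    \<open>open_left\<close> requires.\<close>
  have az: "a n < z" for n using ag[of n] z(1)[of "Suc n"] by simp
  have "z \<in> H" if H: "closed H" "\<And>n. \<exists>x\<in>H. a n \<le> x \<and> x \<le> z" for H
  proof (rule ccontr)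
    assume "z \<notin> H"
    then obtain b where b: "b < z" "{b<..z} \<subseteq> - H" using open_left[of "- H" z "a 0"] H az by auto
    obtain n where "b < a n" using near[OF b(1)] by blast
    moreover obtain x where "x \<in> H" "a n \<le> x" "x \<le> z" using H(2) by blast
    ultimately have "x \<in> {b<..z}" by auto
    then show False using b \<open>x \<in> H\<close> by blast
  qed
  moreover have "\<exists>x\<in>F. a n \<le> x \<and> x \<le> z" for n using aF z(1) by blast
  moreover have "\<exists>x\<in>G. a n \<le> x \<and> x \<le> z" for n
    using g[of "a n"] ag(2)[of n] z(1)[of "Suc n"] by (intro bexI[of _ "g (a n)"]) auto
  ultimately show ?thesis using assms(1,2) by blast
qed

text \<open>If \<open>k\<close> is not a limit, some open \<open>V k\<close> is left cofinally.
  Regularity gives a closed neighbourhood \<open>W\<close> inside it; the preimages of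
  \<open>W\<close> and of the complement of \<open>V k\<close> are disjoint and closed, so the first
  is bounded and a tail avoids a neighbourhood of \<open>k\<close>. Were this so at every
  \<open>k\<close>, a finite cover would leave a tail nowhere to go.\<close>

lemma long_ray_limit_exists:
  assumes f: "continuous_map (euclidean :: long_ray topology) K f"
    and K: "compact_space K" "Hausdorff_space K"
  obtains k where "k \<in> topspace K" "\<And>V. openin K V \<Longrightarrow> k \<in> V \<Longrightarrow> \<exists>b. \<forall>x>b. f x \<in> V"
proof -
  define limit where "limit k \<longleftrightarrow> (\<forall>V. openin K V \<and> k \<in> V \<longrightarrow> (\<exists>b. \<forall>x>b. f x \<in> V))" for k
  have "\<exists>k\<in>topspace K. limit k"
  proof (rule ccontr)
    assume no: "\<not> (\<exists>k\<in>topspace K. limit k)"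
    have "\<exists>V. openin K V \<and> k \<in> V \<and> (\<forall>b. \<exists>x>b. f x \<notin> V)" if "k \<in> topspace K" for k
      using no that by (auto simp: limit_def)
    then obtain V where V: "\<And>k. k \<in> topspace K \<Longrightarrow> openin K (V k) \<and> k \<in> V k \<and> (\<forall>b. \<exists>x>b. f x \<notin> V k)"
      by metis
    have "\<exists>U b. openin K U \<and> k \<in> U \<and> (\<forall>x>b. f x \<notin> U)" if k: "k \<in> topspace K" for k
    proof -
      have "neighbourhood_base_of (closedin K) K"
        using compact_Hausdorff_imp_regular_space[OF K] by (simp add: neighbourhood_base_of_closedin)
      then obtain U W where UW: "openin K U" "closedin K W" "k \<in> U" "U \<subseteq> W" "W \<subseteq> V k"
        using V[OF k] unfolding neighbourhood_base_of by metis
      let ?F = "f -` W" and ?G = "f -` (topspace K - V k)"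
      have "closed ?F" "closed ?G"
        using closedin_continuous_map_preimage[OF f UW(2)]
          closedin_continuous_map_preimage[OF f, of "topspace K - V k"] V[OF k]
        by (auto simp: vimage_def)
      moreover have "?F \<inter> ?G = {}" using UW by auto
      moreover have "\<exists>x\<in>?G. b < x" for b
        using V[OF k] continuous_map_image_subset_topspace[OF f] by fastforce
      ultimately obtain b where "\<forall>x\<in>?F. \<not> b < x" using long_ray_closed_unbounded_meet[of ?F ?G] by blast
      then show ?thesis using UW by (intro exI[of _ U] exI[of _ b]) auto
    qed
    then obtain U b where U: "\<And>k. k \<in> topspace K \<Longrightarrow> openin K (U k) \<and> k \<in> U k \<and> (\<forall>x>b k. f x \<notin> U k)"
      by metis
    have "topspace K \<subseteq> \<Union> (U ` topspace K)" using U by blast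
    then obtain \<F> where \<F>: "finite \<F>" "\<F> \<subseteq> U ` topspace K" "topspace K \<subseteq> \<Union> \<F>"
      using K(1) U unfolding compact_space_alt by (metis (no_types, lifting) imageE)
    then obtain S where S: "finite S" "S \<subseteq> topspace K" "\<F> = U ` S" by (meson finite_subset_image)
    obtain c where c: "\<And>k. k \<in> S \<Longrightarrow> b k \<le> c"
    proof (cases "S = {}")
      case False
      then show ?thesis using that[of "Max (b ` S)"] S(1) by auto
    qed (use that in auto)
    obtain x where "c < x" using long_ray_gt_ex by blast
    then have "f x \<notin> \<Union> \<F>" using S c U by (meson UN_E in_mono le_less_trans)
    moreover have "f x \<in> topspace K" using continuous_map_image_subset_topspace[OF f] by auto
    ultimately show False using \<F> by blast
  qed
  then show ?thesis using that unfolding limit_def by blast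
qed

section \<open>Identification spaces\<close>

lemma quotient_map_proj:
  assumes E: "equiv (topspace X) E"
  shows "quotient_map X (quotient_topology X E) (\<lambda>x. E `` {x})"
proof -
  have U: "\<Union> (topspace X // E) = topspace X" by (rule Union_quotient[OF E])
  have "openin (quotient_topology X E) (topspace X // E)"
    by (simp add: openin_quotient_topology[OF E] U)
  then have top: "topspace (quotient_topology X E) = topspace X // E"
    using openin_quotient_topology[OF E] openin_subset openin_topspace by (metis subset_antisym)
  have pre: "{x \<in> topspace X. E `` {x} \<in> U} = \<Union> U" if sub: "U \<subseteq> topspace X // E" for U
  proof (intro equalityI subsetI)
    fix x assume "x \<in> {x \<in> topspace X. E `` {x} \<in> U}"
    then show "x \<in> \<Union> U" using equiv_class_self[OF E, of x] by blast
  next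
    fix x assume "x \<in> \<Union> U"
    then obtain A where A: "A \<in> U" "x \<in> A" by blast
    then obtain y where "y \<in> topspace X" "A = E `` {y}" using sub by (blast elim: quotientE)
    then have "E `` {x} = A" "x \<in> topspace X"
      using A equiv_class_eq[OF E, of y x] equiv_type[OF E] by auto
    then show "x \<in> {x \<in> topspace X. E `` {x} \<in> U}" using A by simp
  qed
  show ?thesis
    unfolding quotient_map_def top
  proof (intro conjI allI impI)
    show "(\<lambda>x. E `` {x}) ` topspace X = topspace X // E" by (auto simp: quotient_def)
  qed (simp add: pre openin_quotient_topology[OF E])
qed

text \<open>A continuous surjection from a compact space to a Hausdorff one is a quotient map. Two
  quotient maps of \<open>X\<close> with the same fibres factor through each other.\<close>

lemma homeomorphic_quotient_topology:
  assumes E: "equiv (topspace X) E" and X: "compact_space X" and K: "Hausdorff_space K"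
    and f: "continuous_map X K f" "f ` topspace X = topspace K"
    and ker: "\<And>x y. x \<in> topspace X \<Longrightarrow> y \<in> topspace X \<Longrightarrow> f x = f y \<longleftrightarrow> (x, y) \<in> E"
  shows "K homeomorphic_space quotient_topology X E"
proof -
  let ?Q = "quotient_topology X E" and ?\<pi> = "\<lambda>x. E `` {x}"
  have q: "quotient_map X K f"
    by (rule continuous_closed_imp_quotient_map[OF f(1) continuous_imp_closed_map[OF f(1) X K] f(2)])
  note p = quotient_map_proj[OF E]
  have ker': "f x = f y \<longleftrightarrow> ?\<pi> x = ?\<pi> y" if "x \<in> topspace X" "y \<in> topspace X" for x y
    using ker[OF that] eq_equiv_class_iff[OF E that] by simp
  obtain g where g: "continuous_map K ?Q g" "\<And>x. x \<in> topspace X \<Longrightarrow> g (f x) = ?\<pi> x"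
    using quotient_map_lift_exists[OF q quotient_imp_continuous_map[OF p]] ker' by metis
  obtain g' where g': "continuous_map ?Q K g'" "\<And>x. x \<in> topspace X \<Longrightarrow> g' (?\<pi> x) = f x"
    using quotient_map_lift_exists[OF p quotient_imp_continuous_map[OF q]] ker' by metis
  have "homeomorphic_maps K ?Q g g'"
    unfolding homeomorphic_maps_def
  proof (intro conjI ballI g(1) g'(1))
    show "g' (g y) = y" if "y \<in> topspace K" for y
      using that g(2) g'(2) unfolding f(2)[symmetric] by auto
    show "g (g' y) = y" if "y \<in> topspace ?Q" for y
      using that g(2) g'(2) quotient_imp_surjective_map[OF p, symmetric] by auto
  qed
  then show ?thesis unfolding homeomorphic_space_def by blast
qed

text \<open>
  The identifications below glue each added endpoint to an old point, so they are the kernel of the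
  map \<open>\<rho>\<close> that moves the added endpoints and fixes the rest.
\<close>

lemma rtrancl_kernel:
  assumes "\<And>x y. (x, y) \<in> P \<Longrightarrow> \<rho> x = \<rho> y" and "\<And>x. x = \<rho> x \<or> (x, \<rho> x) \<in> P"
  shows "(x, y) \<in> (P \<union> P\<inverse>)\<^sup>* \<longleftrightarrow> \<rho> x = \<rho> y"
proof
  assume "(x, y) \<in> (P \<union> P\<inverse>)\<^sup>*"
  then show "\<rho> x = \<rho> y" by (induction rule: rtrancl_induct) (use assms(1) in \<open>force+\<close>)
next
  have 1: "(z, \<rho> z) \<in> (P \<union> P\<inverse>)\<^sup>*" for z using assms(2)[of z] by (metis UnI1 r_into_rtrancl rtrancl.rtrancl_refl)
  have 2: "(\<rho> z, z) \<in> (P \<union> P\<inverse>)\<^sup>*" for z using assms(2)[of z] by (metis UnI2 converseI r_into_rtrancl rtrancl.rtrancl_refl)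
  assume "\<rho> x = \<rho> y"
  then show "(x, y) \<in> (P \<union> P\<inverse>)\<^sup>*" using 1[of x] 2[of y] by (metis rtrancl_trans)
qed

lemma homeomorphic_identify:
  assumes "compact_space X" "Hausdorff_space K" "continuous_map X K f" "f ` topspace X = topspace K"
    and "\<And>x y. (x, y) \<in> P \<Longrightarrow> \<rho> x = \<rho> y" "\<And>x. x = \<rho> x \<or> (x, \<rho> x) \<in> P"
    and "\<And>x y. x \<in> topspace X \<Longrightarrow> y \<in> topspace X \<Longrightarrow> f x = f y \<longleftrightarrow> \<rho> x = \<rho> y"
  shows "K homeomorphic_space identify X P"
  unfolding identify_def
  by (rule homeomorphic_quotient_topology[OF equiv_identify assms(1-4)])
    (use rtrancl_kernel[of P \<rho>, OF assms(5,6)] assms(7) in auto)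

lemma identify_proj:
  assumes "\<And>x y. (x, y) \<in> P \<Longrightarrow> \<rho> x = \<rho> y" "\<And>x. x = \<rho> x \<or> (x, \<rho> x) \<in> P"
  obtains \<pi> where "continuous_map X (identify X P) \<pi>" "\<pi> ` topspace X = topspace (identify X P)"
    "\<And>x y. x \<in> topspace X \<Longrightarrow> y \<in> topspace X \<Longrightarrow> \<pi> x = \<pi> y \<longleftrightarrow> \<rho> x = \<rho> y"
proof -
  let ?E = "Restr ((P \<union> P\<inverse>)\<^sup>*) (topspace X)"
  have q: "quotient_map X (identify X P) (\<lambda>x. ?E `` {x})"
    unfolding identify_def by (rule quotient_map_proj[OF equiv_identify])
  show ?thesis
  proof (rule that[OF quotient_imp_continuous_map[OF q] quotient_imp_surjective_map[OF q]])
    fix x y assume xy: "x \<in> topspace X" "y \<in> topspace X"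
    show "?E `` {x} = ?E `` {y} \<longleftrightarrow> \<rho> x = \<rho> y"
      using eq_equiv_class_iff[OF equiv_identify xy, of P] rtrancl_kernel[of P \<rho>, OF assms] xy by auto
  qed
qed

section \<open>Identifications of the one-point compactification of the ray\<close>

lemma compact_long_ray_interval: "compact {x..y :: long_ray}"
  by (rule locally_real_compact_interval[OF locally_real_long_ray])

text \<open>The hypothesis \<open>lim\<close> is continuity at infinity of the extension sending
  \<open>None\<close> to \<open>h p\<close>: the points that \<open>h\<close> keeps outside
  \<open>V\<close> form a closed bounded set, hence a compact one. The fibres of the extension are
  exactly those of the identification.\<close>

lemma homeomorphic_identify_alpha_ray:
  assumes K: "Hausdorff_space K" and h: "continuous_map euclidean K h" "bij_betw h UNIV (topspace K)"
    and lim: "\<And>V. openin K V \<Longrightarrow> h p \<in> V \<Longrightarrow> \<exists>b. \<forall>x>b. h x \<in> V"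
  shows "K homeomorphic_space identify alpha_ray {(None, Some p)}"
proof (rule homeomorphic_identify[OF _ K])
  let ?f = "case_option (h p) h" and ?\<rho> = "case_option (Some p) Some"
  show "compact_space alpha_ray" by (simp add: alpha_ray_def)
  have im: "range h = topspace K" using h(2) by (simp add: bij_betw_def)
  show "continuous_map alpha_ray K ?f"
    unfolding continuous_map
  proof (intro conjI allI impI)
    show "?f ` topspace alpha_ray \<subseteq> topspace K" using im by (auto simp: alpha_ray_def split: option.splits)
    fix V assume V: "openin K V"
    have U: "open (h -` V)" using openin_continuous_map_preimage[OF h(1) V] by (simp add: vimage_def)
    show "openin alpha_ray {x \<in> topspace alpha_ray. ?f x \<in> V}"
    proof (cases "h p \<in> V")
      case True
      then obtain b where b: "\<forall>x>b. h x \<in> V" using lim[OF V] by blast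
      let ?C = "- (h -` V)"
      have "x \<le> b" if "x \<in> ?C" for x using b that not_less[of b x] by auto
      then have "?C = {0..b} \<inter> ?C" by auto
      moreover have "compact ({0..b} \<inter> ?C)" using U by (intro compact_Int_closed compact_long_ray_interval) auto
      ultimately have "compact ?C" by simp
      moreover have "{x \<in> topspace alpha_ray. ?f x \<in> V} = insert None (Some ` (UNIV - ?C))"
      proof (rule set_eqI)
        show "x \<in> {x \<in> topspace alpha_ray. ?f x \<in> V} \<longleftrightarrow> x \<in> insert None (Some ` (UNIV - ?C))" for x
          using True by (cases x) (auto simp: alpha_ray_def)
      qed
      ultimately show ?thesis using U unfolding alpha_ray_def openin_Alexandroff_compactification
        by (intro disjI2 exI[of _ ?C]) (auto simp: compactin_euclidean_iff)
    next
      case False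
      then have "{x \<in> topspace alpha_ray. ?f x \<in> V} = Some ` (h -` V)"
        by (auto simp: alpha_ray_def)
      then show ?thesis using U by (simp add: alpha_ray_def)
    qed
  qed
  show "?f ` topspace alpha_ray = topspace K"
    using im by (auto simp: alpha_ray_def image_image)
  show "?f x = ?f y \<longleftrightarrow> ?\<rho> x = ?\<rho> y" for x y
    using bij_betw_imp_inj_on[OF h(2)] by (auto split: option.splits dest: injD)
  show "?\<rho> x = ?\<rho> y" if "(x, y) \<in> {(None, Some p)}" for x y using that by auto
  show "x = ?\<rho> x \<or> (x, ?\<rho> x) \<in> {(None, Some p)}" for x by (cases x) auto
qed

text \<open>The added point is glued to an old one, so the projection restricted to the ray stays
  onto while becoming injective.\<close>

lemma identify_alpha_ray_inj_image:
  obtains h where "continuous_map (euclidean :: long_ray topology) (identify alpha_ray {(None, Some p)}) h"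
    "bij_betw h UNIV (topspace (identify alpha_ray {(None, Some p)}))"
proof -
  let ?X = "identify alpha_ray {(None, Some p)}" and ?\<rho> = "case_option (Some p) Some"
  obtain \<pi> where \<pi>: "continuous_map alpha_ray ?X \<pi>" "\<pi> ` topspace alpha_ray = topspace ?X"
    "\<And>x y. x \<in> topspace alpha_ray \<Longrightarrow> y \<in> topspace alpha_ray \<Longrightarrow> \<pi> x = \<pi> y \<longleftrightarrow> ?\<rho> x = ?\<rho> y"
  proof (rule identify_proj[of "{(None, Some p)}" ?\<rho> alpha_ray])
    show "?\<rho> x = ?\<rho> y" if "(x, y) \<in> {(None, Some p)}" for x y using that by auto
    show "x = ?\<rho> x \<or> (x, ?\<rho> x) \<in> {(None, Some p)}" for x by (cases x) auto
  qed blast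
  have top: "topspace alpha_ray = insert None (range Some)" by (simp add: alpha_ray_def)
  have "continuous_map euclidean ?X (\<pi> \<circ> Some)"
    by (rule continuous_map_compose[OF _ \<pi>(1)]) (simp add: alpha_ray_def continuous_map_Some)
  moreover have "bij_betw (\<pi> \<circ> Some) UNIV (topspace ?X)"
    unfolding bij_betw_def
  proof
    show "inj (\<pi> \<circ> Some)" by (rule injI) (use \<pi>(3) top in auto)
    have "\<pi> None = \<pi> (Some p)" using \<pi>(3)[of None "Some p"] top by simp
    then show "range (\<pi> \<circ> Some) = topspace ?X" unfolding \<pi>(2)[symmetric] top by auto
  qed
  ultimately show ?thesis using that by blast
qed

section \<open>Identifications of the two-point compactification of the line\<close>

lemma extended_less: "Fin x < Pinf" "Minf < Fin x" "Minf < (Pinf :: 'a::order extended)"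
  by (simp_all add: less_extended_def)

lemma range_Fin: "range Fin = {Minf<..<(Pinf :: 'a::linorder extended)}"
proof (intro equalityI subsetI)
  fix z :: "'a extended" assume "z \<in> {Minf<..<Pinf}"
  then show "z \<in> range Fin" by (cases z) auto
qed (auto simp: less_extended_def)

lemma order_iso_Fin: "order_iso UNIV (\<le>) (range Fin) (\<le>) (Fin :: 'a::linorder \<Rightarrow> 'a extended)"
  by (rule order_isoI) auto

lemma convex_range_Fin: "x \<in> range Fin \<Longrightarrow> y \<in> range Fin \<Longrightarrow> {x..y} \<subseteq> range (Fin :: 'a::linorder \<Rightarrow> 'a extended)"
  unfolding range_Fin by auto

lemma continuous_on_Fin: "continuous_on UNIV (Fin :: 'a::linorder_topology \<Rightarrow> 'a extended)"
  by (rule order_iso_continuous_on[OF order_iso_Fin convex_range_Fin])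

text \<open>The inverse of \<open>Fin\<close> on its range is itself an order isomorphism onto a
  convex set, hence continuous, and the range is open.\<close>

lemma open_image_Fin:
  fixes U :: "'a::linorder_topology set"
  assumes "open U"
  shows "open (Fin ` U)"
proof -
  have "continuous_on (range Fin) (inv_into UNIV (Fin :: 'a \<Rightarrow> 'a extended))"
    by (rule order_iso_continuous_on[OF order_iso_inv[OF order_iso_Fin]]) auto
  then have "open (inv_into UNIV (Fin :: 'a \<Rightarrow> 'a extended) -` U \<inter> range Fin)"
    using continuous_on_open_vimage[of "range (Fin :: 'a \<Rightarrow> 'a extended)"] assms range_Fin
    by (metis open_greaterThanLessThan)
  moreover have "inv_into UNIV Fin -` U \<inter> range Fin = Fin ` U"
    by (auto simp: inj_on_def inv_f_f)
  ultimately show ?thesis by simp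
qed

lemma compact_long_line_interval: "compact {x..y :: long_line}"
  by (rule locally_real_compact_interval[OF locally_real_long_line])

text \<open>The members of a cover that contain the two ends swallow both tails; what remains lies
  in a compact interval of the line.\<close>

lemma compact_space_gamma_line: "compact_space gamma_line"
proof -
  have "compact (UNIV :: long_line extended set)"
  proof (rule compactI)
    fix \<U> :: "long_line extended set set"
    assume op: "\<forall>U\<in>\<U>. open U" and cover: "UNIV \<subseteq> \<Union> \<U>"
    obtain U V where U: "U \<in> \<U>" "Minf \<in> U" and V: "V \<in> \<U>" "Pinf \<in> V"
      using cover by (metis UNIV_I UnionE subsetD)
    obtain b where b: "Minf < b" "{Minf..<b} \<subseteq> U" using open_right[of U Minf Pinf] op U extended_less by blast
    obtain d where d: "d < Pinf" "{d<..Pinf} \<subseteq> V" using open_left[of V Pinf Minf] op V extended_less by blast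
    \<comment> \<open>Here \<open>b\<close> may be \<open>Pinf\<close>, so a finite point is chosen
      to cut off the lower tail; \<open>d'\<close> does the same above.\<close>
    obtain b' where b': "Fin b' \<le> b" using b(1) by (cases b) auto
    obtain d' where d': "d \<le> Fin d'" using d(1) by (cases d) auto
    have "compact (Fin ` {b'..d'})"
      by (rule compact_continuous_image[OF continuous_on_subset[OF continuous_on_Fin] compact_long_line_interval]) simp
    then obtain \<F> where \<F>: "\<F> \<subseteq> \<U>" "finite \<F>" "Fin ` {b'..d'} \<subseteq> \<Union> \<F>"
      using compactE[of "Fin ` {b'..d'}" \<U>] op cover by (metis subset_UNIV subset_trans)
    have "z \<in> U \<union> V \<union> \<Union> \<F>" for z
    proof (cases z)
      case (Fin x)
      consider "x < b'" | "d' < x" | "x \<in> {b'..d'}" by fastforce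
      then show ?thesis
      proof cases
        case 1
        then have "z \<in> {Minf..<b}" using Fin b' by (auto intro: less_le_trans[of _ "Fin b'"])
        then show ?thesis using b by blast
      next
        case 2
        then have "z \<in> {d<..Pinf}" using Fin d' by (auto intro: le_less_trans[of _ "Fin d'"])
        then show ?thesis using d by blast
      qed (use \<F> Fin in blast)
    qed (use U V in auto)
    then show "\<exists>C'\<subseteq>\<U>. finite C' \<and> UNIV \<subseteq> \<Union> C'"
      using U V \<F> by (intro exI[of _ "insert U (insert V \<F>)"]) (auto, blast)
  qed
  then show ?thesis by (simp add: gamma_line_def compact_space_def)
qed

abbreviation line_identification :: "long_line \<Rightarrow> long_line \<Rightarrow> (long_line extended \<times> long_line extended) set"
  where "line_identification a b \<equiv> {(Minf, Fin a), (Pinf, Fin b)}"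

text \<open>As for the ray, \<open>lim\<close> is continuity at the added ends. Since the
  compactification has the order topology, neighbourhoods of the ends are tested directly by
  tails.\<close>

lemma homeomorphic_identify_gamma_line:
  assumes K: "Hausdorff_space K" and h: "continuous_map euclidean K h" "bij_betw h UNIV (topspace K)"
    and lim: "\<And>V. openin K V \<Longrightarrow> h a \<in> V \<Longrightarrow> \<exists>c. \<forall>x<c. h x \<in> V"
      "\<And>V. openin K V \<Longrightarrow> h b \<in> V \<Longrightarrow> \<exists>c. \<forall>x>c. h x \<in> V"
  shows "K homeomorphic_space identify gamma_line (line_identification a b)"
proof (rule homeomorphic_identify[OF compact_space_gamma_line K])
  let ?\<rho> = "case_extended Fin (Fin b) (Fin a)" and ?f = "case_extended h (h b) (h a)"
  have im: "range h = topspace K" using h(2) by (simp add: bij_betw_def)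
  show "continuous_map gamma_line K ?f"
    unfolding continuous_map gamma_line_def
  proof (intro conjI allI impI)
    show "?f ` topspace euclidean \<subseteq> topspace K" using im by (auto split: extended.splits)
    fix V assume V: "openin K V"
    have U: "open (h -` V)" using openin_continuous_map_preimage[OF h(1) V] by (simp add: vimage_def)
    have "\<exists>T. open T \<and> z \<in> T \<and> T \<subseteq> {x. ?f x \<in> V}" if z: "?f z \<in> V" for z
    proof (cases z)
      case (Fin x)
      then show ?thesis using z U by (intro exI[of _ "Fin ` (h -` V)"]) (auto simp: open_image_Fin)
    next
      case Pinf
      then obtain c where c: "\<forall>x>c. h x \<in> V" using lim(2)[OF V] z by auto
      have "?f y \<in> V" if "Fin c < y" for y using that z c Pinf by (cases y) auto
      then show ?thesis using Pinf extended_less by (intro exI[of _ "{Fin c<..}"]) auto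
    next
      case Minf
      then obtain c where c: "\<forall>x<c. h x \<in> V" using lim(1)[OF V] z by auto
      have "?f y \<in> V" if "y < Fin c" for y using that z c Minf by (cases y) auto
      then show ?thesis using Minf extended_less by (intro exI[of _ "{..<Fin c}"]) auto
    qed
    then have "open {x. ?f x \<in> V}" by (subst open_subopen) auto
    then show "openin euclidean {x \<in> topspace euclidean. ?f x \<in> V}" by simp
  qed
  have "z \<in> ?f ` UNIV" if z: "z \<in> topspace K" for z
  proof -
    obtain x where "z = h x" using z im by auto
    then have "z = ?f (Fin x)" by simp
    then show ?thesis by blast
  qed
  then show "?f ` topspace gamma_line = topspace K"
    using im by (auto simp: gamma_line_def split: extended.splits)
  show "?f x = ?f y \<longleftrightarrow> ?\<rho> x = ?\<rho> y" for x y
    using bij_betw_imp_inj_on[OF h(2)] by (auto split: extended.splits dest: injD)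
  show "?\<rho> x = ?\<rho> y" if "(x, y) \<in> line_identification a b" for x y using that by auto
  show "x = ?\<rho> x \<or> (x, ?\<rho> x) \<in> line_identification a b" for x by (cases x) auto
qed

lemma identify_gamma_line_inj_image:
  obtains h where "continuous_map (euclidean :: long_line topology) (identify gamma_line (line_identification a b)) h"
    "bij_betw h UNIV (topspace (identify gamma_line (line_identification a b)))"
proof -
  let ?X = "identify gamma_line (line_identification a b)"
  let ?\<rho> = "case_extended Fin (Fin b) (Fin a)"
  obtain \<pi> where \<pi>: "continuous_map gamma_line ?X \<pi>" "\<pi> ` topspace gamma_line = topspace ?X"
    "\<And>x y. x \<in> topspace gamma_line \<Longrightarrow> y \<in> topspace gamma_line \<Longrightarrow> \<pi> x = \<pi> y \<longleftrightarrow> ?\<rho> x = ?\<rho> y"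
  proof (rule identify_proj[of "line_identification a b" ?\<rho> gamma_line])
    show "?\<rho> x = ?\<rho> y" if "(x, y) \<in> line_identification a b" for x y using that by auto
    show "x = ?\<rho> x \<or> (x, ?\<rho> x) \<in> line_identification a b" for x by (cases x) auto
  qed blast
  have top: "topspace gamma_line = UNIV" by (simp add: gamma_line_def)
  have "continuous_map euclidean ?X (\<pi> \<circ> Fin)"
    by (rule continuous_map_compose[OF _ \<pi>(1)]) (simp add: gamma_line_def continuous_on_Fin)
  moreover have "bij_betw (\<pi> \<circ> Fin) UNIV (topspace ?X)"
    unfolding bij_betw_def
  proof
    show "inj (\<pi> \<circ> Fin)" by (rule injI) (use \<pi>(3) top in auto)
    have e: "\<pi> Minf = \<pi> (Fin a)" "\<pi> Pinf = \<pi> (Fin b)"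
      using \<pi>(3)[of Minf "Fin a"] \<pi>(3)[of Pinf "Fin b"] top by simp_all
    have "\<pi> z \<in> range (\<pi> \<circ> Fin)" for z by (cases z) (auto simp: e)
    then show "range (\<pi> \<circ> Fin) = topspace ?X" unfolding \<pi>(2)[symmetric] top by auto
  qed
  ultimately show ?thesis using that by blast
qed

section \<open>The order of an \<open>\<aleph>\<^sub>0\<close>-arc connected space\<close>

definition chart :: "'a topology \<Rightarrow> 'a \<Rightarrow> 'a \<Rightarrow> (real \<Rightarrow> 'a) \<Rightarrow> bool" where
  "chart K a b \<phi> \<longleftrightarrow> continuous_map (top_of_set {0..1}) K \<phi> \<and> inj_on \<phi> {0..1} \<and>
     (\<exists>s\<in>{0..1}. \<exists>t\<in>{0..1}. s < t \<and> \<phi> s = a \<and> \<phi> t = b)"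

text \<open>A single chart is enough as a witness; \<open>chart_le_iff\<close> shows that every
  other chart through both points agrees.\<close>

definition chart_le :: "'a topology \<Rightarrow> 'a \<Rightarrow> 'a \<Rightarrow> 'a \<Rightarrow> 'a \<Rightarrow> bool" where
  "chart_le K a b x y \<longleftrightarrow> (\<exists>\<phi>. chart K a b \<phi> \<and> (\<exists>s\<in>{0..1}. \<exists>t\<in>{0..1}. s \<le> t \<and> \<phi> s = x \<and> \<phi> t = y))"

lemma chart_mem: "chart K a b \<phi> \<Longrightarrow> t \<in> {0..1} \<Longrightarrow> \<phi> t \<in> topspace K"
  unfolding chart_def using continuous_map_image_subset_topspace[of "top_of_set {0..1}" K \<phi>] by auto

lemma chart_exists:
  assumes K: "aleph0_ac K" and ab: "a \<in> topspace K" "b \<in> topspace K" "a \<noteq> b"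
    and S: "S \<subseteq> topspace K" "countable S"
  obtains \<phi> where "chart K a b \<phi>" "S \<subseteq> \<phi> ` {0..1}"
proof -
  have "insert a (insert b S) \<subseteq> topspace K \<and> countable (insert a (insert b S))" using ab S by auto
  then obtain A where A: "A \<subseteq> topspace K" "is_arc (subtopology K A)" "insert a (insert b S) \<subseteq> A"
    using K unfolding aleph0_ac_def by metis
  then obtain f g where fg: "homeomorphic_maps (top_of_set {0..1::real}) (subtopology K A) f g"
    unfolding is_arc_def homeomorphic_space_def using homeomorphic_maps_sym by metis
  have top: "topspace (subtopology K A) = A" using A(1) by auto
  have f: "continuous_map (top_of_set {0..1}) K f"
    using fg continuous_map_into_fulltopology unfolding homeomorphic_maps_def by blast
  have inj: "inj_on f {0..1}" using fg unfolding homeomorphic_maps_def by (intro inj_on_inverseI[of _ g]) auto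
  have gA: "g x \<in> {0..1} \<and> f (g x) = x" if "x \<in> A" for x
    using fg that top continuous_map_image_subset_topspace[of "subtopology K A" "top_of_set {0..1::real}" g]
    unfolding homeomorphic_maps_def by auto
  have im: "insert a (insert b S) \<subseteq> f ` {0..1}" using A(3) gA by (metis image_eqI subset_iff)
  define s t where "s = g a" and "t = g b"
  have st: "s \<in> {0..1}" "t \<in> {0..1}" "f s = a" "f t = b" using gA A(3) by (auto simp: s_def t_def)
  consider "s < t" | "t < s" using st ab(3) by (metis linorder_less_linear)
  then show ?thesis
  proof cases
    case 1
    then have "chart K a b f" unfolding chart_def using f inj st by blast
    then show ?thesis using that im by blast
  next
    \<comment> \<open>The arc runs from \<open>b\<close> to \<open>a\<close>, so its parameter is
      reversed.\<close>
    case 2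
    let ?r = "\<lambda>t::real. 1 - t"
    have r: "?r ` {0..1} = {0..1}" using image_diff_atLeastAtMost[of 1 0 "1::real"] by simp
    have "continuous_map (top_of_set {0..1}) (top_of_set {0..1}) ?r"
      by (auto simp: continuous_map_in_subtopology intro!: continuous_intros)
    then have "continuous_map (top_of_set {0..1}) K (f \<circ> ?r)" using f by (rule continuous_map_compose)
    moreover have "inj_on (f \<circ> ?r) {0..1}"
      by (rule comp_inj_on) (simp_all only: r inj, simp add: inj_on_def)
    moreover have "1 - s \<in> {0..1}" "1 - t \<in> {0..1}" "1 - s < 1 - t" "(f \<circ> ?r) (1 - s) = a" "(f \<circ> ?r) (1 - t) = b"
      using 2 st by auto
    ultimately have "chart K a b (f \<circ> ?r)" unfolding chart_def by blast
    moreover have "S \<subseteq> (f \<circ> ?r) ` {0..1}" using im r by (metis image_comp insert_subset)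
    ultimately show ?thesis using that by blast
  qed
qed

lemma chart_closed_map:
  assumes "chart K a b \<phi>" "Hausdorff_space K"
  shows "closed_map (top_of_set {0..1}) K \<phi>"
  by (rule continuous_imp_closed_map[OF _ _ assms(2)])
    (use assms(1) in \<open>auto simp: chart_def compact_space_subtopology\<close>)

text \<open>Rational parameters are dense, so countably many points control a whole arc. This is how
  a hypothesis on countable sets gets hold of uncountable ones.\<close>

lemma chart_range_dense:
  assumes \<phi>: "chart K a b \<phi>" and C: "closedin K C" and sub: "\<phi> ` (\<rat> \<inter> {0..1}) \<subseteq> C"
  shows "\<phi> ` {0..1} \<subseteq> C"
proof -
  let ?T = "{t \<in> {0..1}. \<phi> t \<in> C}"
  have "closedin (top_of_set {0..1}) ?T"
    using closedin_continuous_map_preimage[OF _ C, of "top_of_set {0..1}" \<phi>] \<phi> by (simp add: chart_def)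
  then have "closed ?T" by (rule closedin_closed_trans) simp
  moreover have "{0<..<1} \<inter> \<rat> \<subseteq> ?T" using sub by auto
  ultimately have "closure ({0<..<1} \<inter> \<rat>) \<subseteq> ?T" by (rule closure_minimal[rotated])
  moreover have "closure ({0<..<1::real} \<inter> \<rat>) = {0..1}"
    by (subst closure_open_Int_superset) (simp_all add: Rats_closure_real)
  ultimately show ?thesis by auto
qed

text \<open>One arc contains countable dense subsets of both given arcs. Being compact in a
  Hausdorff space it is closed, so it contains the arcs themselves.\<close>

lemma chart_extend:
  assumes K: "aleph0_ac K" "Hausdorff_space K" and ab: "a \<in> topspace K" "b \<in> topspace K" "a \<noteq> b"
    and \<phi>: "chart K a b \<phi>" and \<psi>: "chart K a b \<psi>" and S: "S \<subseteq> topspace K" "countable S"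
  obtains \<theta> where "chart K a b \<theta>" "\<phi> ` {0..1} \<subseteq> \<theta> ` {0..1}" "\<psi> ` {0..1} \<subseteq> \<theta> ` {0..1}" "S \<subseteq> \<theta> ` {0..1}"
proof -
  let ?D = "\<phi> ` (\<rat> \<inter> {0..1}) \<union> \<psi> ` (\<rat> \<inter> {0..1}) \<union> S"
  have "countable ?D" using S countable_rat by (intro countable_Un countable_image) auto
  moreover have "?D \<subseteq> topspace K" using S chart_mem[OF \<phi>] chart_mem[OF \<psi>] by auto
  ultimately obtain \<theta> where \<theta>: "chart K a b \<theta>" "?D \<subseteq> \<theta> ` {0..1}" using chart_exists[OF K(1) ab] by metis
  have "closedin K (\<theta> ` {0..1})" using chart_closed_map[OF \<theta>(1) K(2)] by (simp add: closed_map_def)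
  then have "\<phi> ` {0..1} \<subseteq> \<theta> ` {0..1}" "\<psi> ` {0..1} \<subseteq> \<theta> ` {0..1}"
    using chart_range_dense[OF \<phi>] chart_range_dense[OF \<psi>] \<theta>(2) by auto
  then show ?thesis using that \<theta> by blast
qed

text \<open>The change of parameter is continuous and injective on an interval, hence strictly
  monotone; the common orientation by \<open>a\<close> and \<open>b\<close> leaves only the
  increasing case.\<close>

lemma chart_transition:
  assumes \<phi>: "chart K a b \<phi>" and \<psi>: "chart K a b \<psi>" and K: "Hausdorff_space K"
    and sub: "\<phi> ` {0..1} \<subseteq> \<psi> ` {0..1}"
  obtains h where "continuous_on {0..1} h" "strict_mono_on {0..1} h"
    "\<And>s. s \<in> {0..1} \<Longrightarrow> h s \<in> {0..1} \<and> \<psi> (h s) = \<phi> s"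
proof -
  have "embedding_map (top_of_set {0..1}) K \<psi>"
    using \<psi> chart_closed_map[OF \<psi> K] unfolding chart_def by (intro injective_closed_imp_embedding_map) auto
  then obtain g where g: "homeomorphic_maps (top_of_set {0..1}) (subtopology K (\<psi> ` {0..1})) \<psi> g"
    unfolding embedding_map_def homeomorphic_map_maps by auto
  define h where "h = g \<circ> \<phi>"
  have "continuous_map (top_of_set {0..1}) (subtopology K (\<psi> ` {0..1})) \<phi>"
    using \<phi> sub by (auto simp: chart_def continuous_map_in_subtopology)
  then have hc: "continuous_map (top_of_set {0..1}) (top_of_set {0..1}) h"
    using g unfolding h_def homeomorphic_maps_def by (blast intro: continuous_map_compose)
  then have him: "h s \<in> {0..1}" if "s \<in> {0..1}" for s
    using that by (auto simp: continuous_map_in_subtopology)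
  have h: "\<psi> (h s) = \<phi> s" if "s \<in> {0..1}" for s
  proof -
    have "\<phi> s \<in> topspace (subtopology K (\<psi> ` {0..1}))" using chart_mem[OF \<phi> that] sub that by auto
    then show ?thesis using g unfolding h_def homeomorphic_maps_def by simp
  qed
  have cont: "continuous_on {0..1} h" using hc by (auto simp: continuous_map_in_subtopology)
  have inj: "inj_on h {0..1}"
  proof (rule inj_onI)
    fix s t :: real assume "s \<in> {0..1}" "t \<in> {0..1}" "h s = h t"
    then show "s = t" using h \<phi> unfolding chart_def by (metis inj_onD)
  qed
  then consider "strict_mono_on {0..1} h" | "strict_antimono_on {0..1} h"
    using injective_eq_monotone_map[OF _ cont] is_interval_cc by blast
  then have "strict_mono_on {0..1} h"
  proof cases
    \<comment> \<open>A decreasing change of parameter would put \<open>b\<close> before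
      \<open>a\<close> in \<open>\<psi>\<close>.\<close>
    case 2
    obtain s t where st: "s \<in> {0..1}" "t \<in> {0..1}" "s < t" "\<phi> s = a" "\<phi> t = b"
      using \<phi> unfolding chart_def by blast
    obtain s' t' where st': "s' \<in> {0..1}" "t' \<in> {0..1}" "s' < t'" "\<psi> s' = a" "\<psi> t' = b"
      using \<psi> unfolding chart_def by blast
    have "inj_on \<psi> {0..1}" using \<psi> by (simp add: chart_def)
    then have "h s = s'" "h t = t'" using h him st st' by (metis inj_onD)+
    moreover have "h t < h s" using 2 st by (auto simp: monotone_on_def)
    ultimately show ?thesis using st' by simp
  qed
  then show ?thesis using that cont h him by blast
qed

text \<open>The witnessing chart and the given one both enter a third, and increasing parameter
  changes preserve the comparison.\<close>

lemma chart_le_iff: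
  assumes K: "aleph0_ac K" "Hausdorff_space K" and ab: "a \<in> topspace K" "b \<in> topspace K" "a \<noteq> b"
    and \<phi>: "chart K a b \<phi>" and st: "s \<in> {0..1}" "t \<in> {0..1}"
  shows "chart_le K a b (\<phi> s) (\<phi> t) \<longleftrightarrow> s \<le> t"
proof
  show "s \<le> t \<Longrightarrow> chart_le K a b (\<phi> s) (\<phi> t)" unfolding chart_le_def using \<phi> st by blast
  assume "chart_le K a b (\<phi> s) (\<phi> t)"
  then obtain \<psi> s' t' where \<psi>: "chart K a b \<psi>" and st': "s' \<in> {0..1}" "t' \<in> {0..1}" "s' \<le> t'"
    "\<psi> s' = \<phi> s" "\<psi> t' = \<phi> t" unfolding chart_le_def by blast
  obtain \<theta> where \<theta>: "chart K a b \<theta>" "\<phi> ` {0..1} \<subseteq> \<theta> ` {0..1}" "\<psi> ` {0..1} \<subseteq> \<theta> ` {0..1}"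
    by (rule chart_extend[OF K ab \<phi> \<psi>, of "{}"]) auto
  obtain h where h: "strict_mono_on {0..1} h" "\<And>s. s \<in> {0..1} \<Longrightarrow> h s \<in> {0..1} \<and> \<theta> (h s) = \<phi> s"
    using chart_transition[OF \<phi> \<theta>(1) K(2) \<theta>(2)] by metis
  obtain k where k: "strict_mono_on {0..1} k" "\<And>s. s \<in> {0..1} \<Longrightarrow> k s \<in> {0..1} \<and> \<theta> (k s) = \<psi> s"
    using chart_transition[OF \<psi> \<theta>(1) K(2) \<theta>(3)] by metis
  have "inj_on \<theta> {0..1}" using \<theta>(1) by (simp add: chart_def)
  then have "k s' = h s" "k t' = h t" using h(2) k(2) st st' by (metis inj_onD)+
  moreover have "k s' \<le> k t'" using k(1) st' by (auto simp: monotone_on_def order_le_less)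
  ultimately have "h s \<le> h t" by simp
  then show "s \<le> t" using h(1) st by (metis linorder_not_le monotone_onD)
qed

lemma aleph0_ac_arc_order:
  assumes K: "aleph0_ac K" "Hausdorff_space K"
  obtains le a b where "arc_order K le" "a \<in> topspace K" "b \<in> topspace K" "a \<noteq> b"
    "\<And>S. S \<subseteq> topspace K \<Longrightarrow> countable S \<Longrightarrow>
       \<exists>u\<in>topspace K. \<exists>v\<in>topspace K. \<forall>x\<in>S. le u x \<and> le x v"
proof -
  \<comment> \<open>Already the empty set lies in an arc, whose ends provide two distinct points of
    \<open>K\<close>.\<close>
  obtain A where A: "A \<subseteq> topspace K" "is_arc (subtopology K A)"
    using K(1) unfolding aleph0_ac_def by (metis countable_empty empty_subsetI)
  obtain f g where "homeomorphic_maps (top_of_set {0..1::real}) (subtopology K A) f g"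
    using A(2) unfolding is_arc_def homeomorphic_space_def using homeomorphic_maps_sym by metis
  then have "f 0 \<in> topspace K" "f 1 \<in> topspace K" "f 0 \<noteq> f 1"
    using continuous_map_image_subset_topspace[of "top_of_set {0..1::real}" "subtopology K A" f]
    unfolding homeomorphic_maps_def by (auto simp: image_subset_iff dest: arg_cong[of _ _ g])
  then obtain a b where ab: "a \<in> topspace K" "b \<in> topspace K" "a \<noteq> b" by blast
  let ?le = "chart_le K a b"
  note le_iff = chart_le_iff[OF K ab]
  have common: "\<exists>\<phi>. chart K a b \<phi> \<and> S \<subseteq> \<phi> ` {0..1}" if "S \<subseteq> topspace K" "countable S" for S
    using chart_exists[OF K(1) ab that] by metis
  have lin: "linear_on (topspace K) ?le"
  proof (rule linear_onI)
    fix x y z assume "x \<in> topspace K" "y \<in> topspace K" "z \<in> topspace K" and le: "?le x y" "?le y z"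
    then obtain \<phi> where \<phi>: "chart K a b \<phi>" "{x, y, z} \<subseteq> \<phi> ` {0..1}" using common[of "{x, y, z}"] by auto
    then have "x \<in> \<phi> ` {0..1}" "y \<in> \<phi> ` {0..1}" "z \<in> \<phi> ` {0..1}" by auto
    then obtain r s t where rst: "r \<in> {0..1}" "x = \<phi> r" "s \<in> {0..1}" "y = \<phi> s" "t \<in> {0..1}" "z = \<phi> t"
      by (elim imageE)
    then have "r \<le> s" "s \<le> t" using le le_iff[OF \<phi>(1)] by simp_all
    then show "?le x z" using rst le_iff[OF \<phi>(1)] by simp
  next
    fix x y assume xy: "x \<in> topspace K" "y \<in> topspace K"
    then obtain \<phi> where \<phi>: "chart K a b \<phi>" "{x, y} \<subseteq> \<phi> ` {0..1}" using common[of "{x, y}"] by auto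
    then have "x \<in> \<phi> ` {0..1}" "y \<in> \<phi> ` {0..1}" by auto
    then obtain s t where st: "s \<in> {0..1}" "x = \<phi> s" "t \<in> {0..1}" "y = \<phi> t"
      by (elim imageE)
    show "?le x y \<or> ?le y x" using st le_iff[OF \<phi>(1)] by auto
    show "x = y" if "?le x y" "?le y x" using st le_iff[OF \<phi>(1)] that by simp
    show "?le x x" using st le_iff[OF \<phi>(1)] by simp
  qed
  have "\<exists>k. order_iso {0..1::real} (\<le>) (seg (topspace K) ?le x y) ?le k \<and>
             continuous_map (top_of_set {0..1}) K k"
    if xy: "x \<in> topspace K" "y \<in> topspace K" "?le x y" "x \<noteq> y" for x y
  proof -
    obtain \<phi> s t where \<phi>: "chart K a b \<phi>" and st: "s \<in> {0..1}" "t \<in> {0..1}" "s \<le> t" "\<phi> s = x" "\<phi> t = y"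
      using xy(3) unfolding chart_le_def by blast
    have "s < t" using st xy(4) by (cases "s = t") auto
    \<comment> \<open>Subarcs are order-convex: a point between the ends lies on some larger arc,
      and the continuous change of parameter takes every intermediate value, so the point was on the
      subarc already.\<close>
    have im: "\<phi> ` {s..t} = seg (topspace K) ?le x y"
    proof (intro equalityI subsetI)
      fix z assume "z \<in> \<phi> ` {s..t}"
      then obtain r where r: "r \<in> {s..t}" "z = \<phi> r" by blast
      then have "r \<in> {0..1}" using st by auto
      then show "z \<in> seg (topspace K) ?le x y"
        using le_iff[OF \<phi>, of s r] le_iff[OF \<phi>, of r t] r st chart_mem[OF \<phi>] by (auto simp: seg_def)
    next
      fix z assume "z \<in> seg (topspace K) ?le x y"
      then have z: "z \<in> topspace K" "?le x z" "?le z y" by (auto simp: seg_def)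
      obtain \<theta> where \<theta>: "chart K a b \<theta>" "\<phi> ` {0..1} \<subseteq> \<theta> ` {0..1}" "{z} \<subseteq> \<theta> ` {0..1}"
        by (rule chart_extend[OF K ab \<phi> \<phi>, of "{z}"]) (use z in auto)
      obtain h where h: "continuous_on {0..1} h" "\<And>s. s \<in> {0..1} \<Longrightarrow> h s \<in> {0..1} \<and> \<theta> (h s) = \<phi> s"
        using chart_transition[OF \<phi> \<theta>(1) K(2) \<theta>(2)] by metis
      obtain r where r: "r \<in> {0..1}" "z = \<theta> r" using \<theta>(3) by blast
      have "h s \<le> r" "r \<le> h t"
        using le_iff[OF \<theta>(1), of "h s" r] le_iff[OF \<theta>(1), of r "h t"] z r st h(2) by auto
      moreover have "continuous_on {s..t} h" by (rule continuous_on_subset[OF h(1)]) (use st in auto)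
      ultimately obtain r' where r': "s \<le> r'" "r' \<le> t" "h r' = r" using IVT'[of h s r t] st(3) by blast
      then have "z = \<phi> r'" using h(2)[of r'] st r by auto
      then show "z \<in> \<phi> ` {s..t}" using r' by auto
    qed
    have "order_iso {s..t} (\<le>) (seg (topspace K) ?le x y) ?le \<phi>"
      unfolding order_iso_def
    proof
      have "inj_on \<phi> {0..1}" using \<phi> by (simp add: chart_def)
      then have "inj_on \<phi> {s..t}" by (rule inj_on_subset) (use st in auto)
      then show "bij_betw \<phi> {s..t} (seg (topspace K) ?le x y)" using im by (simp add: bij_betw_def)
      show "\<forall>x\<in>{s..t}. \<forall>y\<in>{s..t}. x \<le> y \<longleftrightarrow> ?le (\<phi> x) (\<phi> y)" using le_iff[OF \<phi>] st by auto
    qed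
    from order_iso_comp[OF order_iso_real_interval[OF \<open>s < t\<close>] this]
    have "order_iso {0..1} (\<le>) (seg (topspace K) ?le x y) ?le (\<phi> \<circ> (\<lambda>r. s + r * (t - s)))" .
    moreover have "continuous_map (top_of_set {0..1}) K (\<phi> \<circ> (\<lambda>r. s + r * (t - s)))"
    proof (rule continuous_map_compose)
      have "(\<lambda>r. s + r * (t - s)) ` {0..1} \<subseteq> {0..1}"
        using order_iso_image[OF order_iso_real_interval[OF \<open>s < t\<close>]] st by auto
      then show "continuous_map (top_of_set {0..1}) (top_of_set {0..1}) (\<lambda>r. s + r * (t - s))"
        by (auto simp: continuous_map_in_subtopology intro!: continuous_intros)
      show "continuous_map (top_of_set {0..1}) K \<phi>" using \<phi> by (simp add: chart_def)
    qed
    ultimately show ?thesis by blast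
  qed
  then have "arc_order K ?le" using lin unfolding arc_order_def by blast
  moreover have "\<exists>u\<in>topspace K. \<exists>v\<in>topspace K. \<forall>x\<in>S. ?le u x \<and> ?le x v"
    if S: "S \<subseteq> topspace K" "countable S" for S
  proof -
    obtain \<phi> where \<phi>: "chart K a b \<phi>" "S \<subseteq> \<phi> ` {0..1}" using common[OF S] by blast
    have "?le (\<phi> 0) x \<and> ?le x (\<phi> 1)" if x: "x \<in> S" for x
    proof -
      obtain t where "t \<in> {0..1}" "x = \<phi> t" using \<phi>(2) x by blast
      then show ?thesis using le_iff[OF \<phi>(1), of 0 t] le_iff[OF \<phi>(1), of t 1] by auto
    qed
    then show ?thesis using chart_mem[OF \<phi>(1), of 0] chart_mem[OF \<phi>(1), of 1] by auto
  qed
  ultimately show ?thesis using that[OF _ ab] by blast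
qed

section \<open>The classification\<close>

definition long_interval_image :: "'a topology \<Rightarrow> bool" where
  "long_interval_image K \<longleftrightarrow> (\<exists>J :: long_line set. closed_interval J \<and>
     (\<exists>f. continuous_map (top_of_set J) K f \<and> inj_on f J \<and> f ` J = topspace K))"

lemma long_interval_imageI:
  fixes J :: "long_line set"
  assumes "closed_interval J" "continuous_map (top_of_set J) K f" "inj_on f J" "f ` J = topspace K"
  shows "long_interval_image K"
  using assms unfolding long_interval_image_def by blast

lemma homeomorphic_injective_image:
  assumes "K homeomorphic_space X" and f: "continuous_map Y X f" "bij_betw f (topspace Y) (topspace X)"
  obtains g where "continuous_map Y K g" "bij_betw g (topspace Y) (topspace K)"
proof -
  obtain u where u: "homeomorphic_map X K u"
    using assms(1) homeomorphic_space homeomorphic_space_sym by metis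
  have "bij_betw u (topspace X) (topspace K)"
    using homeomorphic_imp_injective_map[OF u] homeomorphic_imp_surjective_map[OF u] by (simp add: bij_betw_def)
  then show ?thesis
    using that[of "u \<circ> f"] continuous_map_compose[OF f(1) homeomorphic_imp_continuous_map[OF u]]
      bij_betw_trans[OF f(2)] by blast
qed

lemma long_line_zero_neq_one: "(0 :: long_line) \<noteq> 1"
  using long_line_zero_less_one by (metis less_irrefl)

lemma closed_interval_zero_one:
  fixes J :: "long_line set"
  assumes "closed J" "\<And>x y. x \<in> J \<Longrightarrow> y \<in> J \<Longrightarrow> {x..y} \<subseteq> J" "0 \<in> J" "1 \<in> J"
  shows "closed_interval J"
  using assms long_line_zero_neq_one unfolding closed_interval_def by blast

section \<open>From the list to injective images of intervals\<close>

lemma long_interval_image_arc: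
  assumes "is_arc K"
  shows "long_interval_image K"
proof -
  have "is_arc (top_of_set {0..1::long_line})"
    by (rule locally_real_is_arc_interval[OF locally_real_long_line]) simp
  then have "K homeomorphic_space top_of_set {0..1::long_line}"
    using assms unfolding is_arc_def using homeomorphic_space_sym homeomorphic_space_trans by metis
  then obtain g where g: "homeomorphic_map (top_of_set {0..1::long_line}) K g"
    using homeomorphic_space homeomorphic_space_sym by metis
  have "closed_interval {0..1::long_line}"
    by (rule closed_interval_zero_one) (auto intro: less_imp_le)
  then show ?thesis
    by (rule long_interval_imageI[where f = g])
      (use homeomorphic_imp_continuous_map[OF g] homeomorphic_imp_injective_map[OF g]
        homeomorphic_imp_surjective_map[OF g] in simp_all)
qed

lemma long_interval_image_ray:
  assumes "K homeomorphic_space identify alpha_ray {(None, Some p)}"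
  shows "long_interval_image K"
proof -
  obtain h where h: "continuous_map (euclidean :: long_ray topology) (identify alpha_ray {(None, Some p)}) h"
    "bij_betw h UNIV (topspace (identify alpha_ray {(None, Some p)}))"
    by (rule identify_alpha_ray_inj_image)
  then obtain g where g: "continuous_map (euclidean :: long_ray topology) K g" "bij_betw g UNIV (topspace K)"
    using homeomorphic_injective_image[OF assms h(1)] by auto
  note inv = order_iso_inv[OF order_iso_line_of_ray]
  have "continuous_on {0..} (inv_into UNIV line_of_ray)" by (rule order_iso_continuous_on[OF inv]) simp
  then have "continuous_map (top_of_set {0..}) euclidean (inv_into UNIV line_of_ray)" by simp
  from continuous_map_compose[OF this g(1)] bij_betw_trans[OF order_iso_bij[OF inv] g(2)]
  have "continuous_map (top_of_set {0..}) K (g \<circ> inv_into UNIV line_of_ray)"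
    "bij_betw (g \<circ> inv_into UNIV line_of_ray) {0..} (topspace K)" .
  moreover have "closed_interval {0::long_line..}"
    by (rule closed_interval_zero_one) (auto intro: less_imp_le)
  ultimately show ?thesis unfolding long_interval_image_def bij_betw_def by blast
qed

lemma long_interval_image_line:
  assumes "K homeomorphic_space identify gamma_line (line_identification a b)"
  shows "long_interval_image K"
proof -
  obtain h where h: "continuous_map (euclidean :: long_line topology) (identify gamma_line (line_identification a b)) h"
    "bij_betw h UNIV (topspace (identify gamma_line (line_identification a b)))"
    by (rule identify_gamma_line_inj_image)
  then obtain g where "continuous_map (euclidean :: long_line topology) K g" "bij_betw g UNIV (topspace K)"
    using homeomorphic_injective_image[OF assms h(1)] by auto
  moreover have "closed_interval (UNIV :: long_line set)" by (rule closed_interval_zero_one) auto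
  ultimately show ?thesis by (intro long_interval_imageI[of UNIV K g]) (auto simp: bij_betw_def)
qed

section \<open>From injective images to arcs through countable sets\<close>

text \<open>\<open>S\<close> has a bound \<open>w\<close> in the long line. Either \<open>J\<close>
  reaches past \<open>w\<close>, or \<open>w\<close> bounds \<open>J\<close> and then closedness and
  compactness give \<open>J\<close> a greatest element.\<close>

lemma closed_interval_upper_bound:
  fixes J :: "long_line set"
  assumes "closed J" "J \<noteq> {}" "S \<subseteq> J" "countable S"
  shows "\<exists>v\<in>J. \<forall>s\<in>S. s \<le> v"
proof -
  obtain w where w: "\<And>s. s \<in> S \<Longrightarrow> s \<le> w"
    using long_rightD[OF long_right_long_line, of S] assms(4) by auto
  obtain x where x: "x \<in> J" using assms(2) by blast
  show ?thesis
  proof (cases "\<exists>j\<in>J. w \<le> j")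
    case True
    then show ?thesis using w by (meson order_trans)
  next
    case False
    then have J: "j \<le> w" if "j \<in> J" for j using that by (meson linear)
    have "compact ({x..w} \<inter> J)" by (rule compact_Int_closed[OF compact_long_line_interval assms(1)])
    then obtain m where m: "m \<in> {x..w} \<inter> J" "\<And>t. t \<in> {x..w} \<inter> J \<Longrightarrow> t \<le> m"
      using compact_attains_sup[of "{x..w} \<inter> J"] x J[OF x] by (metis IntI atLeastAtMost_iff empty_iff order_refl)
    have "s \<le> m" if "s \<in> S" for s
      using m(1) m(2)[of s] J[of s] that assms(3) by (cases "x \<le> s") auto
    then show ?thesis using m(1) by blast
  qed
qed

lemma closed_interval_lower_bound:
  fixes J :: "long_line set"
  assumes "closed J" "J \<noteq> {}" "S \<subseteq> J" "countable S"
  shows "\<exists>v\<in>J. \<forall>s\<in>S. v \<le> s"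
proof -
  obtain w where w: "\<And>s. s \<in> S \<Longrightarrow> w \<le> s"
    using long_rightD[OF long_left_long_line, of S] assms(4) by auto
  obtain x where x: "x \<in> J" using assms(2) by blast
  show ?thesis
  proof (cases "\<exists>j\<in>J. j \<le> w")
    case True
    then show ?thesis using w by (meson order_trans)
  next
    case False
    then have J: "w \<le> j" if "j \<in> J" for j using that by (meson linear)
    have "compact ({w..x} \<inter> J)" by (rule compact_Int_closed[OF compact_long_line_interval assms(1)])
    then obtain m where m: "m \<in> {w..x} \<inter> J" "\<And>t. t \<in> {w..x} \<inter> J \<Longrightarrow> m \<le> t"
      using compact_attains_inf[of "{w..x} \<inter> J"] x J[OF x] by (metis IntI atLeastAtMost_iff empty_iff order_refl)
    have "m \<le> s" if "s \<in> S" for s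
      using m(1) m(2)[of s] J[of s] that assms(3) by (cases "s \<le> x") auto
    then show ?thesis using m(1) by blast
  qed
qed

text \<open>A countable set pulls back into one compact interval of \<open>J\<close>, on which an
  injective continuous map is an embedding.\<close>

lemma long_interval_image_imp_aleph0_ac:
  assumes "long_interval_image K" "Hausdorff_space K"
  shows "aleph0_ac K"
  unfolding aleph0_ac_def
proof (intro allI impI)
  fix S assume S: "S \<subseteq> topspace K \<and> countable S"
  obtain J :: "long_line set" and f where J: "closed_interval J"
    and f: "continuous_map (top_of_set J) K f" "inj_on f J" "f ` J = topspace K"
    using assms(1) unfolding long_interval_image_def by blast
  obtain x y where xy: "x \<in> J" "y \<in> J" "x \<noteq> y" using J unfolding closed_interval_def by blast
  have cl: "closed J" using J unfolding closed_interval_def by blast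
  \<comment> \<open>The two distinct points keep the interval nondegenerate when \<open>S\<close>
    has at most one point.\<close>
  let ?T = "insert x (insert y (inv_into J f ` S))"
  have "inv_into J f ` S \<subseteq> J" using S f(3) by (auto intro!: inv_into_into)
  then have T: "?T \<subseteq> J" "countable ?T" "J \<noteq> {}" using xy S by auto
  obtain u v where u: "u \<in> J" "\<And>s. s \<in> ?T \<Longrightarrow> u \<le> s" and v: "v \<in> J" "\<And>s. s \<in> ?T \<Longrightarrow> s \<le> v"
    using closed_interval_lower_bound[OF cl T(3,1,2)] closed_interval_upper_bound[OF cl T(3,1,2)] by blast
  have "u < v" using u(2)[of x] u(2)[of y] v(2)[of x] v(2)[of y] xy(3) by auto
  have sub: "{u..v} \<subseteq> J" using J u(1) v(1) unfolding closed_interval_def by blast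
  have "is_arc (subtopology K (f ` topspace (top_of_set {u..v})))"
  proof (rule is_arc_inj_image[OF _ _ _ assms(2)])
    show "is_arc (top_of_set {u..v})"
      by (rule locally_real_is_arc_interval[OF locally_real_long_line \<open>u < v\<close>])
    show "continuous_map (top_of_set {u..v}) K f" by (rule continuous_map_from_subtopology_mono[OF f(1) sub])
    show "inj_on f (topspace (top_of_set {u..v}))" using inj_on_subset[OF f(2) sub] by simp
  qed
  moreover have "S \<subseteq> f ` {u..v}"
  proof
    fix s assume s: "s \<in> S"
    then have "inv_into J f s \<in> {u..v}" using u(2) v(2) by auto
    moreover have "f (inv_into J f s) = s" using s S f(3) by (auto intro!: f_inv_into_f)
    ultimately show "s \<in> f ` {u..v}" by (metis image_eqI)
  qed
  moreover have "f ` {u..v} \<subseteq> topspace K" using sub f(3) by blast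
  ultimately show "\<exists>A\<subseteq>topspace K. is_arc (subtopology K A) \<and> S \<subseteq> A" by auto
qed

section \<open>From the order to the list\<close>

lemma arc_order_ends_is_arc:
  assumes K: "arc_order K le" "Hausdorff_space K" and m: "m \<in> topspace K" "M \<in> topspace K" "m \<noteq> M"
    and ends: "\<And>x. x \<in> topspace K \<Longrightarrow> le m x \<and> le x M"
  shows "is_arc K"
proof -
  have "seg (topspace K) le m M = topspace K" using ends by (auto simp: seg_def)
  then obtain k where k: "order_iso {0..1::real} (\<le>) (topspace K) le k" "continuous_map (top_of_set {0..1}) K k"
    using arc_orderD[OF K(1) m(1,2) _ m(3)] ends m by metis
  have "is_arc (top_of_set {0..1::real})" unfolding is_arc_def by (rule homeomorphic_space_refl)
  from is_arc_inj_image[OF this k(2) _ K(2)] show ?thesis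
    using order_iso_inj[OF k(1)] order_iso_image[OF k(1)] by (simp add: subtopology_topspace)
qed

lemma arc_order_one_end:
  assumes K: "compact_space K" "Hausdorff_space K" "arc_order K le" and long: "long_right (topspace K) le"
    and m: "m \<in> topspace K" "\<And>x. x \<in> topspace K \<Longrightarrow> le m x"
  shows "K homeomorphic_space long_circle \<or> (\<exists>p. p \<noteq> 0 \<and> K homeomorphic_space long_lollipop p)"
proof -
  obtain h where h: "order_iso (UNIV :: long_ray set) (\<le>) (topspace K) le h"
    by (rule long_ray_order_iso[OF arc_order_linear[OF K(3)] arc_order_locally_real[OF K(3)] long m])
  have cont: "continuous_map euclidean K h"
    by (rule arc_order_iso_continuous_map[OF K(3) h long_ray_gt_ex]) (use long_ray_zero_le in blast)
  obtain k where k: "k \<in> topspace K" "\<And>V. openin K V \<Longrightarrow> k \<in> V \<Longrightarrow> \<exists>b. \<forall>x>b. h x \<in> V"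
    by (rule long_ray_limit_exists[OF cont K(1,2)]) blast
  obtain p where p: "k = h p" using k(1) order_iso_image[OF h] by blast
  have "K homeomorphic_space identify alpha_ray {(None, Some p)}"
    by (rule homeomorphic_identify_alpha_ray[OF K(2) cont order_iso_bij[OF h]]) (use k(2) p in auto)
  then show ?thesis unfolding long_circle_def long_lollipop_def by (cases "p = 0") auto
qed

lemma long_line_order_iso:
  assumes A: "linear_on A le" "locally_real A le" "long_right A le" "long_right A (\<lambda>x y. le y x)"
    and u: "u \<in> A" "v \<in> A" "le u v" and eq: "a \<le> b" "a = b \<longleftrightarrow> u = v"
  obtains h where "order_iso (UNIV :: long_line set) (\<le>) A le h" "h a = u" "h b = v"
  by (rule two_sided_long_order_iso[OF linear_on_linorder locally_real_long_line long_right_long_line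
      long_left_long_line A UNIV_I UNIV_I eq(1) u eq(2)]) (rule that)

lemma long_line_order_iso_continuous_map:
  "arc_order K le \<Longrightarrow> order_iso (UNIV :: long_line set) (\<le>) (topspace K) le h \<Longrightarrow>
    continuous_map euclidean K h"
  by (rule arc_order_iso_continuous_map[OF _ _ long_line_gt_ex]) (use long_line_lt_ex in blast)+

text \<open>The limit is stated through the order of \<open>K\<close> and not through the
  parametrisation that produces it. Both limits must be known before a parametrisation adapted to
  them can be chosen.\<close>

lemma arc_order_limit:
  assumes K: "compact_space K" "Hausdorff_space K" "arc_order K le"
    and long: "long_right (topspace K) le" "long_right (topspace K) (\<lambda>x y. le y x)"
  obtains q where "q \<in> topspace K"
    "\<And>V. openin K V \<Longrightarrow> q \<in> V \<Longrightarrow> \<exists>c\<in>topspace K. \<forall>x\<in>topspace K. le c x \<and> x \<noteq> c \<longrightarrow> x \<in> V"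
proof -
  obtain v where v: "v \<in> topspace K" using long_rightD[OF long(1), of "{}"] by auto
  have "le v v" by (rule linear_onD(1)[OF arc_order_linear[OF K(3)] v])
  then obtain h where h: "order_iso (UNIV :: long_line set) (\<le>) (topspace K) le h"
    using long_line_order_iso[OF arc_order_linear[OF K(3)] arc_order_locally_real[OF K(3)] long v v _ order_refl]
    by metis
  have "continuous_on UNIV line_of_ray" by (rule order_iso_continuous_on[OF order_iso_line_of_ray]) auto
  then have "continuous_map euclidean K (h \<circ> line_of_ray)"
    by (intro continuous_map_compose[OF _ long_line_order_iso_continuous_map[OF K(3) h]]) simp
  then obtain q where q: "q \<in> topspace K" "\<And>V. openin K V \<Longrightarrow> q \<in> V \<Longrightarrow> \<exists>b. \<forall>x>b. (h \<circ> line_of_ray) x \<in> V"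
    by (rule long_ray_limit_exists[OF _ K(1,2)]) blast
  have "\<exists>c\<in>topspace K. \<forall>x\<in>topspace K. le c x \<and> x \<noteq> c \<longrightarrow> x \<in> V" if V: "openin K V" "q \<in> V" for V
  proof -
    obtain b where b: "\<And>x. b < x \<Longrightarrow> h (line_of_ray x) \<in> V" using q(2)[OF V] by auto
    have "x \<in> V" if x: "x \<in> topspace K" "le (h (line_of_ray b)) x" "x \<noteq> h (line_of_ray b)" for x
    proof -
      obtain z where z: "x = h z" using x(1) order_iso_image[OF h] by blast
      then have zb: "line_of_ray b < z" using x order_iso_le[OF h, of "line_of_ray b" z] by (auto simp: order_less_le)
      then have "z \<in> {0..}" using order_iso_mem[OF order_iso_line_of_ray, of b] by auto
      then obtain y where y: "z = line_of_ray y" using order_iso_image[OF order_iso_line_of_ray] by blast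
      then have "b < y" using zb order_iso_le[OF order_iso_line_of_ray, of y b] by (auto simp: not_le[symmetric])
      then show ?thesis using b z y by simp
    qed
    then show ?thesis using order_iso_mem[OF h, of "line_of_ray b"] by blast
  qed
  then show ?thesis using that q(1) by blast
qed

text \<open>Let \<open>p\<close> and \<open>q\<close> be the limits of the lower and the upper end.
  If they coincide the ends meet in one point; if \<open>p\<close> comes first each end returns on
  its own side, giving the dumbbell; if \<open>q\<close> comes first they cross, giving the
  theta-curve.\<close>

lemma arc_order_no_ends:
  assumes K: "compact_space K" "Hausdorff_space K" "arc_order K le"
    and long: "long_right (topspace K) le" "long_right (topspace K) (\<lambda>x y. le y x)"
  shows "K homeomorphic_space long_dumbbell \<or> K homeomorphic_space long_figure_eight \<or>
    K homeomorphic_space long_theta_curve"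
proof -
  let ?A = "topspace K"
  note lin = arc_order_linear[OF K(3)]
  obtain q where q: "q \<in> ?A" "\<And>V. openin K V \<Longrightarrow> q \<in> V \<Longrightarrow> \<exists>c\<in>?A. \<forall>x\<in>?A. le c x \<and> x \<noteq> c \<longrightarrow> x \<in> V"
    by (rule arc_order_limit[OF K long]) blast
  \<comment> \<open>The lower end is the upper end of the reversed order, so the two length
    hypotheses trade places.\<close>
  obtain p where p: "p \<in> ?A" "\<And>V. openin K V \<Longrightarrow> p \<in> V \<Longrightarrow> \<exists>c\<in>?A. \<forall>x\<in>?A. le x c \<and> x \<noteq> c \<longrightarrow> x \<in> V"
    by (rule arc_order_limit[OF K(1,2) arc_order_dual[OF K(3)] long(2,1)]) blast
  have homeo: "K homeomorphic_space identify gamma_line (line_identification a b)"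
    if h: "order_iso (UNIV :: long_line set) (\<le>) ?A le h" "h a = p" "h b = q" for h a b
  proof (rule homeomorphic_identify_gamma_line[OF K(2) long_line_order_iso_continuous_map[OF K(3) h(1)]
        order_iso_bij[OF h(1)]])
    note le = order_iso_le[OF h(1)] and eq = order_iso_eq[OF h(1)] and mem = order_iso_mem[OF h(1)]
    have onto: "\<exists>z. c = h z" if "c \<in> ?A" for c using that order_iso_image[OF h(1)] by blast
    show "\<exists>c. \<forall>x<c. h x \<in> V" if V: "openin K V" "h a \<in> V" for V
    proof -
      obtain c where "c \<in> ?A" and c: "\<And>x. x \<in> ?A \<Longrightarrow> le x c \<Longrightarrow> x \<noteq> c \<Longrightarrow> x \<in> V" 
        using p(2)[OF V(1)] V(2) h(2) by blast
      then obtain z where "c = h z" using onto by blast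
      then show ?thesis using c le eq mem by (intro exI[of _ z]) auto
    qed
    show "\<exists>c. \<forall>x>c. h x \<in> V" if V: "openin K V" "h b \<in> V" for V
    proof -
      obtain c where "c \<in> ?A" and c: "\<And>x. x \<in> ?A \<Longrightarrow> le c x \<Longrightarrow> x \<noteq> c \<Longrightarrow> x \<in> V" 
        using q(2)[OF V(1)] V(2) h(3) by blast
      then obtain z where "c = h z" using onto by blast
      then show ?thesis using c le eq mem by (intro exI[of _ z]) auto
    qed
  qed
  note iso = long_line_order_iso[OF lin arc_order_locally_real[OF K(3)] long]
  have neg: "- 1 \<le> (1 :: long_line)" "- 1 \<noteq> (1 :: long_line)"
    using less_trans[OF long_line_minus_one_less_zero long_line_zero_less_one] by auto
  consider "p = q" | "le p q" "p \<noteq> q" | "le q p" "p \<noteq> q" using linear_onD(4)[OF lin p(1) q(1)] by blast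
  then show ?thesis
  proof cases
    case 1
    obtain h where "order_iso (UNIV :: long_line set) (\<le>) ?A le h" "h 0 = p"
      using iso[OF p(1) p(1) linear_onD(1)[OF lin p(1)] order_refl[of 0]] by metis
    then show ?thesis using homeo[of h 0 0] 1 by (simp add: long_figure_eight_def)
  next
    case 2
    obtain h where "order_iso (UNIV :: long_line set) (\<le>) ?A le h" "h (- 1) = p" "h 1 = q"
      using iso[OF p(1) q(1) 2(1) neg(1)] neg(2) 2(2) by metis
    then show ?thesis using homeo[of h "- 1" 1] by (simp add: long_dumbbell_def)
  next
    case 3
    obtain h where "order_iso (UNIV :: long_line set) (\<le>) ?A le h" "h (- 1) = q" "h 1 = p"
      using iso[OF q(1) p(1) 3(1) neg(1)] neg(2) 3(2) by metis
    then show ?thesis using homeo[of h 1 "- 1"] by (simp add: long_theta_curve_def)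
  qed
qed

text \<open>Without a greatest element every bound is strictly exceeded, which upgrades countable
  boundedness to a long end.\<close>

lemma no_top_long_right:
  assumes A: "linear_on A le" and bounded: "\<And>S. S \<subseteq> A \<Longrightarrow> countable S \<Longrightarrow> \<exists>v\<in>A. \<forall>x\<in>S. le x v"
    and no_top: "\<not> (\<exists>M\<in>A. \<forall>x\<in>A. le x M)"
  shows "long_right A le"
  unfolding long_right_def
proof (intro allI impI)
  note A' = linear_onD[OF A]
  fix C assume C: "C \<subseteq> A \<and> countable C"
  then obtain v where v: "v \<in> A" "\<And>x. x \<in> C \<Longrightarrow> le x v" using bounded[of C] by blast
  obtain w where w: "w \<in> A" "\<not> le w v" using no_top v(1) by blast
  have vw: "le v w" using A'(4)[OF v(1) w(1)] w(2) by blast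
  have "le c w \<and> c \<noteq> w" if c: "c \<in> C" for c
  proof -
    have "c \<in> A" using C c by blast
    then show ?thesis using A'(2)[OF _ v(1) w(1) v(2)[OF c] vw] v(2)[OF c] w(2) by blast
  qed
  then show "\<exists>u\<in>A. \<forall>c\<in>C. le c u \<and> c \<noteq> u" using w(1) by blast
qed

lemma aleph0_ac_classification:
  assumes K: "compact_space K" "Hausdorff_space K" "aleph0_ac K"
  shows "is_arc K \<or> K homeomorphic_space long_circle \<or>
    (\<exists>p. p \<noteq> 0 \<and> K homeomorphic_space long_lollipop p) \<or> K homeomorphic_space long_dumbbell \<or>
    K homeomorphic_space long_figure_eight \<or> K homeomorphic_space long_theta_curve"
proof -
  let ?A = "topspace K"
  obtain le a b where le: "arc_order K le" and ab: "a \<in> ?A" "b \<in> ?A" "a \<noteq> b"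
    and bounded: "\<And>S. S \<subseteq> ?A \<Longrightarrow> countable S \<Longrightarrow> \<exists>u\<in>?A. \<exists>v\<in>?A. \<forall>x\<in>S. le u x \<and> le x v"
    using aleph0_ac_arc_order[OF K(3,2)] by metis
  note dual = arc_order_dual[OF le]
  have long: "long_right ?A le" if "\<not> (\<exists>M\<in>?A. \<forall>x\<in>?A. le x M)"
  proof (rule no_top_long_right[OF arc_order_linear[OF le] _ that])
    show "\<exists>v\<in>?A. \<forall>x\<in>S. le x v" if "S \<subseteq> ?A" "countable S" for S using bounded[OF that] by blast
  qed
  have long': "long_right ?A (\<lambda>x y. le y x)" if "\<not> (\<exists>m\<in>?A. \<forall>x\<in>?A. le m x)"
  proof (rule no_top_long_right[OF arc_order_linear[OF dual] _ that])
    show "\<exists>v\<in>?A. \<forall>x\<in>S. le v x" if "S \<subseteq> ?A" "countable S" for S using bounded[OF that] by blast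
  qed
  show ?thesis
  proof (cases "\<exists>M\<in>?A. \<forall>x\<in>?A. le x M")
    case True
    then obtain M where M: "M \<in> ?A" "\<And>x. x \<in> ?A \<Longrightarrow> le x M" by blast
    show ?thesis
    proof (cases "\<exists>m\<in>?A. \<forall>x\<in>?A. le m x")
      case True
      then obtain m where m: "m \<in> ?A" "\<And>x. x \<in> ?A \<Longrightarrow> le m x" by blast
      have "m \<noteq> M"
      proof
        assume "m = M"
        then have "x = m" if "x \<in> ?A" for x
          using linear_onD(3)[OF arc_order_linear[OF le] that m(1)] m(2)[OF that] M(2)[OF that] by simp
        then show False using ab by metis
      qed
      then have "is_arc K" using arc_order_ends_is_arc[OF le K(2) m(1) M(1)] m(2) M(2) by simp
      then show ?thesis by blast
    next
      case False
      \<comment> \<open>With a greatest but no least point, the reversed order starts at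
        \<open>M\<close> and has a long upper end.\<close>
      show ?thesis using arc_order_one_end[OF K(1,2) dual long'[OF False] M] by blast
    qed
  next
    case no_top: False
    show ?thesis
    proof (cases "\<exists>m\<in>?A. \<forall>x\<in>?A. le m x")
      case True
      then obtain m where m: "m \<in> ?A" "\<And>x. x \<in> ?A \<Longrightarrow> le m x" by blast
      show ?thesis using arc_order_one_end[OF K(1,2) le long[OF no_top] m] by blast
    next
      case False
      show ?thesis using arc_order_no_ends[OF K(1,2) le long[OF no_top] long'[OF False]] by blast
    qed
  qed
qed

theorem theorem1p4:
  fixes K :: "'a topology"
  assumes "continuum K"
  shows "(aleph0_ac K \<longleftrightarrow>
            (\<exists>J :: long_line set. closed_interval J \<and>
               (\<exists>f. continuous_map (top_of_set J) K f \<and> inj_on f J \<and> f ` J = topspace K))) \<and>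
         ((\<exists>J :: long_line set. closed_interval J \<and>
               (\<exists>f. continuous_map (top_of_set J) K f \<and> inj_on f J \<and> f ` J = topspace K)) \<longleftrightarrow>
            (is_arc K \<or>
             K homeomorphic_space long_circle \<or>
             (\<exists>p. p \<noteq> 0 \<and> K homeomorphic_space long_lollipop p) \<or>
             K homeomorphic_space long_dumbbell \<or>
             K homeomorphic_space long_figure_eight \<or>
             K homeomorphic_space long_theta_curve))"
  (is "_ \<and> (_ \<longleftrightarrow> ?list)")
proof -
  have K: "compact_space K" "Hausdorff_space K" using assms by (auto simp: continuum_def)
  \<comment> \<open>Both equivalences come from one cycle: the list, injective images of intervals,
    arcs through countable sets, and back to the list.\<close>
  have "?list \<Longrightarrow> long_interval_image K"
    unfolding long_circle_def long_lollipop_def long_dumbbell_def long_figure_eight_def long_theta_curve_def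
    using long_interval_image_arc long_interval_image_ray long_interval_image_line by blast
  moreover have "long_interval_image K \<Longrightarrow> aleph0_ac K"
    using long_interval_image_imp_aleph0_ac K(2) by blast
  moreover have "aleph0_ac K \<Longrightarrow> ?list" by (rule aleph0_ac_classification[OF K])
  ultimately have "(aleph0_ac K \<longleftrightarrow> long_interval_image K) \<and> (long_interval_image K \<longleftrightarrow> ?list)"
    by satx
  then show ?thesis by (simp only: long_interval_image_def)
qed

end
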